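(* Let $\mu\in\mathcal M(\mathbf S)$ and let $\mu(dx)=f(x)\sigma(dx)+\nu(dx)$ be the Lebesgue decomposition of $\mu$ with respect to $\sigma$ (so $f\in L^1(\mathbf S,\sigma)$ and $\nu\perp\sigma$). Then $\mathcal P_{\mathbb D}[\mu]$ has the nontangential limit $f(y)$ at $\sigma$-almost every $y\in\mathbf S$.
   Context: Let $d\ge 2$ and $\alpha\in(1,2)$. $\mathbf S=\{x\in\mathbb R^d:|x|=1\}$, $\mathbb D=\mathbb R^d\setminus\mathbf S$, $\sigma$ is the normalized surface measure on $\mathbf S$, and $\mathcal M(\mathbf S)$ is the space of finite signed Borel measures on $\mathbf S$. Let $\mathcal C_2=\pi^{1/2}2^{2-\alpha}\Gamma((\alpha+d)/2-1)/\Gamma((\alpha-1)/2)$ and $\mathcal P_{\mathbb D}(x,y)=\frac{\mathcal C_2}{\Gamma(d/2)}\frac{||x|^2-1|^{\alpha-1}}{|x-y|^{d+\alpha-2}}$ for $x\in\mathbb D$, $y\in\mathbf S$; for $\mu\in\mathcal M(\mathbf S)$, $\mathcal P_{\mathbb D}[\mu](x)=\int_{\mathbf S}\mathcal P_{\mathbb D}(x,y)\mu(dy)$, $x\in\mathbb D$. For $y\in\mathbf S$ and $\beta>0$ let $\Gamma_\beta(y)=\{x\in\mathbb D:|x-y|<(1+\beta)|1-|x||\}$. A function $u$ on $\mathbb D$ has nontangential limit $L$ at $y\in\mathbf S$ if for every $\beta>0$, $\lim_{\Gamma_\beta(y)\ni x\to y}u(x)=L$. *)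

theory Defs
  imports "HOL-Analysis.Analysis"
begin

definition unit_sph :: "'a::euclidean_space set" where
  "unit_sph = sphere 0 1"

definition domD :: "'a::euclidean_space set" where
  "domD = UNIV - unit_sph"

text \<open>Normalized surface measure sigma on S, realised as the (normalised) cone measure:
  sigma(A) = Leb({t x : 0 < t < 1, x in A}) / Leb(unit ball), i.e. the push-forward of
  normalised Lebesgue measure on the unit ball under y \<mapsto> y/|y|.\<close>
definition sigma_S :: "'a::euclidean_space measure" where
  "sigma_S = scale_measure (1 / emeasure lborel (ball (0::'a) 1))
              (distr (density lborel (indicator (ball (0::'a) 1))) borel sgn)"

definition C2 :: "nat \<Rightarrow> real \<Rightarrow> real" where
  "C2 d \<alpha> = sqrt pi * 2 powr (2 - \<alpha>) * Gamma ((\<alpha> + real d) / 2 - 1) / Gamma ((\<alpha> - 1) / 2)"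

definition PD :: "real \<Rightarrow> 'a::euclidean_space \<Rightarrow> 'a \<Rightarrow> real" where
  "PD \<alpha> x y = C2 DIM('a) \<alpha> / Gamma (real DIM('a) / 2) *
     (\<bar>norm x ^ 2 - 1\<bar> powr (\<alpha> - 1) / norm (x - y) powr (real DIM('a) + \<alpha> - 2))"

text \<open>A finite signed Borel measure on S is represented as mu_p - mu_n with mu_p, mu_n finite
  (positive) Borel measures concentrated on S.\<close>
definition fin_meas_on_S :: "'a::euclidean_space measure \<Rightarrow> bool" where
  "fin_meas_on_S M \<longleftrightarrow> sets M = sets borel \<and> finite_measure M \<and> emeasure M (UNIV - unit_sph) = 0"

definition PD_int :: "real \<Rightarrow> 'a::euclidean_space measure \<Rightarrow> 'a measure \<Rightarrow> 'a \<Rightarrow> real" where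
  "PD_int \<alpha> Mp Mn x = (\<integral>y. PD \<alpha> x y \<partial>Mp) - (\<integral>y. PD \<alpha> x y \<partial>Mn)"

definition cone_nt :: "real \<Rightarrow> 'a::euclidean_space \<Rightarrow> 'a set" where
  "cone_nt \<beta> y = {x \<in> domD. norm (x - y) < (1 + \<beta>) * \<bar>1 - norm x\<bar>}"

definition nt_limit :: "('a::euclidean_space \<Rightarrow> real) \<Rightarrow> 'a \<Rightarrow> real \<Rightarrow> bool" where
  "nt_limit u y L \<longleftrightarrow> (\<forall>\<beta>>0. (u \<longlongrightarrow> L) (at y within cone_nt \<beta> y))"

end

theory Submission
  imports Defs "HOL-Probability.Distributions"
begin

text \<open>
  Two facts give the theorem. First, P[sigma](x) tends to 1 as |x| tends to 1. With r = |x|,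
  x = r e and q = 2 r / (1 + r^2), one has |x - y|^2 = (1 + r^2) (1 - q y.e) on the sphere, so the
  binomial series reduces P[sigma] to the moments of y.e under sigma. These come from Gaussian
  integrals by comparing power series: translating the Gaussian gives the generating function of
  the moments of z.e, dilating it gives that of the moments of |z|^2, and their quotients are the
  moments of y.e. The resulting hypergeometric coefficients are asymptotic to those of
  (1 - q^2)^(-(alpha - 1)/2), and an Abelian argument together with the duplication formula
  identifies the limit.

  Second, if a finite positive measure M on S vanishes on a Borel set E, then P[M] has
  nontangential limit 0 at sigma-almost every point of E: by inner regularity M is, up to
  arbitrarily small mass, carried by a compact set disjoint from E, whose contribution tends to 0
  on E, and the small remainder is handled by the weak type bound for the maximal function
  sup M(B(y,r)) / r^(d-1) and Borel-Cantelli. Applied to the singular part it gives the limit 0;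
  applied for each rational q to (f - q)^+ sigma on {f \<le> q} and to (q - f)^+ sigma on
  {f \<ge> q}, it squeezes P[f sigma] between rationals close to f(y).
\<close>

section \<open>The cone measure and polar coordinates\<close>

text \<open>At x = 0 the integral of the kernel against \<open>sigma_S\<close> is the bare constant
  \<open>PD_const\<close>, which in general differs from 1. So no identity P[sigma] = 1 is
  available, and the constant \<open>C2\<close> has to be recognised from the boundary behaviour
  alone. Working with q instead of r treats the inside and the outside of the sphere together, since
  q is unchanged under r -> 1/r; moreover 1 - q^2 = ((r^2 - 1) / (1 + r^2))^2, so the factor of the
  kernel that vanishes on S becomes a power of 1 - q^2. Here \<open>sigma_S\<close> is only a
  push-forward of Lebesgue measure under \<open>sgn\<close>. Gaussians suit this: they split into a
  radial and an angular part, and yet translations and dilations act on them explicitly, so neither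
  a parametrisation of S nor a Beta integral enters. Constants are the only densities whose boundary
  limit comes from a direct computation. This is why f is compared with constant levels, instead of
  using Lebesgue points or approximation by continuous functions, and why the almost everywhere
  argument only ever meets limits equal to 0 of positive measures.\<close>

lemma emeasure_unit_ball_pos_finite:
  "0 < emeasure lborel (ball (0::'a::euclidean_space) 1)"
  "emeasure lborel (ball (0::'a::euclidean_space) 1) < \<infinity>"
proof -
  show "emeasure lborel (ball (0::'a) 1) < \<infinity>"
    by (rule emeasure_lborel_ball_finite)
  have "emeasure lborel (ball (0::'a) 1) \<noteq> 0"
    using open_not_negligible[of "ball (0::'a) 1"] by (simp add: negligible_iff_emeasure0 sets.sets_into_space)
  then show "0 < emeasure lborel (ball (0::'a) 1)"
    using not_gr_zero by blast
qed

lemma sets_sigma_S [simp, measurable_cong]: "sets sigma_S = sets borel"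
  by (simp add: sigma_S_def)

lemma space_sigma_S [simp]: "space sigma_S = UNIV"
  by (simp add: sigma_S_def space_scale_measure)

text \<open>The definition of \<open>sigma_S\<close> unfolded and multiplied out. The volume of the
  ball is neither 0 nor infinite, so this product form determines \<open>sigma_S\<close> and avoids
  division in \<open>ennreal\<close>.\<close>

lemma nn_integral_sigma_S:
  fixes g :: "'a::euclidean_space \<Rightarrow> ennreal"
  assumes [measurable]: "g \<in> borel_measurable borel"
  shows "(\<integral>\<^sup>+z. indicator (ball 0 1) z * g (sgn z) \<partial>lborel)
           = emeasure lborel (ball (0::'a) 1) * (\<integral>\<^sup>+y. g y \<partial>sigma_S)"
proof -
  let ?w = "emeasure lborel (ball (0::'a) 1)"
  have sgn_meas: "(\<integral>\<^sup>+ x. g (sgn x) \<partial>density lborel (indicator (ball 0 1)))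
      = (\<integral>\<^sup>+z. indicator (ball 0 1) z * g (sgn z) \<partial>lborel)"
    by (rule nn_integral_density) (auto intro!: borel_measurable_indicator)
  have w: "?w \<noteq> 0" "?w \<noteq> \<infinity>"
    using emeasure_unit_ball_pos_finite[where 'a='a] by auto
  have "(\<integral>\<^sup>+y. g y \<partial>sigma_S) = 1 / ?w * (\<integral>\<^sup>+z. indicator (ball 0 1) z * g (sgn z) \<partial>lborel)"
    by (simp add: sigma_S_def nn_integral_scale_measure nn_integral_distr nn_integral_density
        sgn_meas)
  also have "?w * \<dots> = (\<integral>\<^sup>+z. indicator (ball 0 1) z * g (sgn z) \<partial>lborel)"
    using w by (simp add: ennreal_divide_times ennreal_times_divide mult.commute[of ?w] ennreal_mult_divide_eq)
  finally show ?thesis by simp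
qed

lemma emeasure_sigma_S:
  fixes A :: "'a::euclidean_space set"
  assumes [measurable]: "A \<in> sets borel"
  shows "emeasure lborel (ball 0 1 \<inter> sgn -` A) = emeasure lborel (ball (0::'a) 1) * emeasure sigma_S A"
proof -
  have "emeasure lborel (ball 0 1 \<inter> sgn -` A) = (\<integral>\<^sup>+z. indicator (ball 0 1 \<inter> sgn -` A) z \<partial>lborel)"
    using measurable_sets[OF borel_measurable_sgn assms] by (intro nn_integral_indicator[symmetric]) auto
  also have "\<dots> = (\<integral>\<^sup>+z. indicator (ball 0 1) z * indicator A (sgn z) \<partial>lborel)"
    by (intro nn_integral_cong) (auto split: split_indicator)
  finally show ?thesis
    using nn_integral_sigma_S[of "indicator A :: 'a \<Rightarrow> _"] by simp
qed

lemma prob_space_sigma_S: "prob_space (sigma_S :: 'a::euclidean_space measure)"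
proof
  let ?w = "emeasure lborel (ball (0::'a) 1)"
  have "?w * emeasure (sigma_S :: 'a measure) UNIV = ?w * 1"
    using emeasure_sigma_S[of "UNIV :: 'a set"] by simp
  then show "emeasure (sigma_S :: 'a measure) (space sigma_S) = 1"
    using emeasure_unit_ball_pos_finite[where 'a='a] by (subst (asm) ennreal_mult_cancel_left) auto
qed

lemma AE_sigma_S_sphere: "AE y in (sigma_S :: 'a::euclidean_space measure). y \<in> unit_sph"
proof (rule AE_I)
  let ?w = "emeasure lborel (ball (0::'a) 1)"
  have [measurable]: "- unit_sph \<in> sets (borel :: 'a measure)" by (auto simp: unit_sph_def)
  have "ball 0 1 \<inter> sgn -` (- unit_sph) \<subseteq> {0::'a}"
    by (auto simp: unit_sph_def norm_sgn split: if_splits)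
  then have "emeasure lborel (ball 0 1 \<inter> sgn -` (- unit_sph :: 'a set)) \<le> emeasure lborel {0::'a}"
    by (intro emeasure_mono) auto
  then have "?w * emeasure sigma_S (- unit_sph :: 'a set) = 0"
    by (subst emeasure_sigma_S[symmetric]) auto
  then show "emeasure sigma_S (- unit_sph :: 'a set) = 0"
    using emeasure_unit_ball_pos_finite[where 'a='a] by auto
qed (auto simp: unit_sph_def)

section \<open>Scaling and the factorisation into radial and angular parts\<close>

lemma nn_integral_lborel_scaleR:
  fixes f :: "'a::euclidean_space \<Rightarrow> ennreal"
  assumes [measurable]: "f \<in> borel_measurable borel" and c: "c > 0"
  shows "(\<integral>\<^sup>+z. f z \<partial>lborel) = ennreal (c ^ DIM('a)) * (\<integral>\<^sup>+z. f (c *\<^sub>R z) \<partial>lborel)"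
proof -
  have "(\<integral>\<^sup>+z. f z \<partial>lborel)
      = (\<integral>\<^sup>+z. f z \<partial>density (distr lborel borel (\<lambda>x. 0 + c *\<^sub>R x)) (\<lambda>_. \<bar>c\<bar>^DIM('a)))"
    using c by (subst lborel_affine[of c 0]) auto
  also have "\<dots> = (\<integral>\<^sup>+z. ennreal (c ^ DIM('a)) * f (c *\<^sub>R z) \<partial>lborel)"
    using c by (simp add: nn_integral_density nn_integral_distr)
  finally show ?thesis by (simp add: nn_integral_cmult)
qed

lemma nn_integral_ball_sgn:
  fixes g :: "'a::euclidean_space \<Rightarrow> ennreal"
  assumes [measurable]: "g \<in> borel_measurable borel" and u: "u > 0"
  shows "(\<integral>\<^sup>+z. indicator {..<u} (norm z) * g (sgn z) \<partial>lborel)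
           = ennreal (u ^ DIM('a)) * (emeasure lborel (ball (0::'a) 1) * (\<integral>\<^sup>+y. g y \<partial>sigma_S))"
proof -
  have "(\<integral>\<^sup>+z. indicator {..<u} (norm z) * g (sgn z) \<partial>lborel)
      = ennreal (u ^ DIM('a)) * (\<integral>\<^sup>+z. indicator {..<u} (norm (u *\<^sub>R z)) * g (sgn (u *\<^sub>R z)) \<partial>lborel)"
    by (rule nn_integral_lborel_scaleR) (use u in auto)
  also have "(\<integral>\<^sup>+z. indicator {..<u} (norm (u *\<^sub>R z)) * g (sgn (u *\<^sub>R z)) \<partial>lborel)
      = (\<integral>\<^sup>+z. indicator (ball 0 1) z * g (sgn z) \<partial>lborel)"
    using u by (intro nn_integral_cong) (auto split: split_indicator simp: sgn_scaleR)
  finally show ?thesis by (simp add: nn_integral_sigma_S)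
qed

text \<open>Both sides integrate \<phi> over a measure on the real line: the law of the norm
  weighted by \<open>g (sgn z)\<close>, and a multiple of the plain law of the norm. They agree on
  every half-line {..<u}, because \<open>sgn\<close> is invariant under dilation and both scale like
  u^d. Half-lines form an intersection-stable generator, so the measures coincide; no radial density
  u^(d-1) has to be computed. Finiteness of the integral of g gives the exhausting half-lines finite
  mass.\<close>

lemma nn_integral_polar:
  fixes g :: "'a::euclidean_space \<Rightarrow> ennreal" and \<phi> :: "real \<Rightarrow> ennreal"
  assumes [measurable]: "g \<in> borel_measurable borel" "\<phi> \<in> borel_measurable borel"
    and fin: "(\<integral>\<^sup>+y. g y \<partial>sigma_S) < \<infinity>"
  shows "(\<integral>\<^sup>+z. \<phi> (norm z) * g (sgn z) \<partial>lborel)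
           = (\<integral>\<^sup>+z. \<phi> (norm (z::'a)) \<partial>lborel) * (\<integral>\<^sup>+y. g y \<partial>sigma_S)"
proof -
  let ?I = "\<integral>\<^sup>+y. g y \<partial>sigma_S"
  interpret sigma: prob_space "sigma_S :: 'a measure" by (rule prob_space_sigma_S)
  define M1 where "M1 = distr (density lborel (\<lambda>z. g (sgn z))) borel (norm :: 'a \<Rightarrow> real)"
  define M2 where "M2 = scale_measure ?I (distr lborel borel (norm :: 'a \<Rightarrow> real))"
  have e1: "emeasure M1 {..<u} = (\<integral>\<^sup>+z. indicator {..<u} (norm z) * g (sgn z) \<partial>lborel)" for u
  proof -
    have "emeasure M1 {..<u} = (\<integral>\<^sup>+z. indicator {..<u} z \<partial>M1)"
      by (rule nn_integral_indicator[symmetric]) (simp add: M1_def)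
    also have "\<dots> = (\<integral>\<^sup>+z. indicator {..<u} (norm z) * g (sgn z) \<partial>lborel)"
      unfolding M1_def
      by (simp add: nn_integral_distr nn_integral_density mult.commute del: nn_integral_indicator)
    finally show ?thesis .
  qed
  have e2: "emeasure M2 {..<u} = ?I * (\<integral>\<^sup>+z. indicator {..<u} (norm (z::'a)) * 1 \<partial>lborel)" for u
  proof -
    have "emeasure (distr lborel borel (norm :: 'a \<Rightarrow> real)) {..<u}
       = (\<integral>\<^sup>+z. indicator {..<u} z \<partial>distr lborel borel (norm :: 'a \<Rightarrow> real))"
      by (rule nn_integral_indicator[symmetric]) simp
    then show ?thesis
      unfolding M2_def by (simp add: nn_integral_distr del: nn_integral_indicator)
  qed
  have eq: "emeasure M1 {..<u} = emeasure M2 {..<u}" for u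
  proof (cases "u > 0")
    case True
    have "(\<integral>\<^sup>+y. 1 \<partial>(sigma_S :: 'a measure)) = 1"
      using sigma.emeasure_space_1 by simp
    with nn_integral_ball_sgn[of "\<lambda>_::'a. 1", OF _ True] nn_integral_ball_sgn[of g, OF _ True]
    show ?thesis unfolding e1 e2 by (simp add: mult_ac)
  next
    case False
    then have "indicator {..<u} (norm z) = (0::ennreal)" for z :: 'a
      using norm_ge_zero[of z] by (auto split: split_indicator simp del: norm_ge_zero)
    then show ?thesis unfolding e1 e2 by simp
  qed
  have "M1 = M2"
  proof (rule measure_eqI_generator_eq[where E="range lessThan" and \<Omega>=UNIV and A="\<lambda>i. {..<real i}"])
    show "Int_stable (range lessThan :: real set set)"
    proof (rule Int_stableI, clarify)
      fix a b :: real
      have "{..<a} \<inter> {..<b} = {..<min a b}" by auto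
      then show "{..<a} \<inter> {..<b} \<in> range lessThan" by blast
    qed
    show "(\<Union>i. {..<real i}) = (UNIV::real set)"
      by (auto intro: reals_Archimedean2)
    show "emeasure M1 {..<real i} \<noteq> \<infinity>" for i
    proof (cases "i = 0")
      case False
      then show ?thesis
        using nn_integral_ball_sgn[of g "real i"] fin emeasure_unit_ball_pos_finite(2)[where 'a='a]
        unfolding e1 by (auto simp: ennreal_mult_eq_top_iff)
    next
      case True
      then show ?thesis unfolding e1
        by (simp add: indicator_def)
    qed
    show "sets M1 = sigma_sets UNIV (range lessThan)" "sets M2 = sigma_sets UNIV (range lessThan)"
      unfolding M1_def M2_def sets_scale_measure sets_distr by (simp_all add: borel_Iio)
    show "emeasure M1 X = emeasure M2 X" if "X \<in> range lessThan" for X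
      using that eq by blast
  qed auto
  have "(\<integral>\<^sup>+z. \<phi> (norm z) * g (sgn z) \<partial>lborel) = (\<integral>\<^sup>+z. \<phi> z \<partial>M1)"
    unfolding M1_def by (simp add: nn_integral_distr nn_integral_density mult.commute)
  also have "\<dots> = (\<integral>\<^sup>+z. \<phi> z \<partial>M2)" by (simp add: \<open>M1 = M2\<close>)
  also have "\<dots> = ?I * (\<integral>\<^sup>+z. \<phi> (norm (z::'a)) \<partial>lborel)"
    unfolding M2_def by (subst nn_integral_scale_measure) (simp_all add: nn_integral_distr)
  finally show ?thesis by (simp add: mult.commute)
qed

lemma integral_polar:
  fixes g :: "'a::euclidean_space \<Rightarrow> real" and \<phi> :: "real \<Rightarrow> real"
  assumes [measurable]: "g \<in> borel_measurable borel" "\<phi> \<in> borel_measurable borel"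
    and bd: "\<And>y. \<bar>g y\<bar> \<le> 1" and nn: "\<And>u. u \<ge> 0 \<Longrightarrow> 0 \<le> \<phi> u"
    and int: "integrable lborel (\<lambda>z::'a. \<phi> (norm z))"
  shows "(\<integral>z. \<phi> (norm z) * g (sgn z) \<partial>lborel)
           = (\<integral>z. \<phi> (norm (z::'a)) \<partial>lborel) * (\<integral>y. g y \<partial>sigma_S)"
proof -
  interpret sigma: prob_space "sigma_S :: 'a measure" by (rule prob_space_sigma_S)
  have ig: "integrable sigma_S g"
    by (rule sigma.integrable_const_bound[where B=1]) (use bd in auto)
  \<comment> \<open>Since |g| <= 1, the shifted function 1 + g falls under the nonnegative version;
    the contribution of the 1 cancels at the end.\<close>
  have g0: "0 \<le> 1 + g y" for y using bd[of y] by linarith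
  have i1: "integrable lborel (\<lambda>z. \<phi> (norm z) * g (sgn z))"
    by (rule Bochner_Integration.integrable_bound[OF int])
       (use bd nn in \<open>auto simp: abs_mult intro!: mult_left_le\<close>)
  have "ennreal (\<integral>z. \<phi> (norm z) * (1 + g (sgn z)) \<partial>lborel)
      = (\<integral>\<^sup>+z. ennreal (\<phi> (norm z) * (1 + g (sgn z))) \<partial>lborel)"
  proof (intro nn_integral_eq_integral[symmetric])
    show "integrable lborel (\<lambda>z. \<phi> (norm z) * (1 + g (sgn z)))"
      using i1 int by (simp add: algebra_simps)
  qed (intro AE_I2 mult_nonneg_nonneg g0 nn norm_ge_zero)
  also have "\<dots> = (\<integral>\<^sup>+z. ennreal (\<phi> (norm z)) * ennreal (1 + g (sgn z)) \<partial>lborel)"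
    using g0 nn by (simp add: ennreal_mult)
  also have "\<dots> = (\<integral>\<^sup>+z. ennreal (\<phi> (norm (z::'a))) \<partial>lborel) * (\<integral>\<^sup>+y. ennreal (1 + g y) \<partial>sigma_S)"
  proof (rule nn_integral_polar)
    show "(\<integral>\<^sup>+y. ennreal (1 + g y) \<partial>sigma_S) < \<infinity>"
      using ig g0 by (subst nn_integral_eq_integral) auto
  qed auto
  also have "\<dots> = ennreal (\<integral>z. \<phi> (norm (z::'a)) \<partial>lborel) * ennreal (\<integral>y. 1 + g y \<partial>sigma_S)"
    using ig g0 int nn by (subst (1 2) nn_integral_eq_integral) auto
  also have "\<dots> = ennreal ((\<integral>z. \<phi> (norm (z::'a)) \<partial>lborel) * (\<integral>y. 1 + g y \<partial>sigma_S))"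
    using nn g0 by (intro ennreal_mult[symmetric] integral_nonneg) auto
  finally have "(\<integral>z. \<phi> (norm z) * (1 + g (sgn z)) \<partial>lborel) = (\<integral>z. \<phi> (norm (z::'a)) \<partial>lborel) * (\<integral>y. 1 + g y \<partial>sigma_S)"
    using nn g0 by (subst (asm) ennreal_inj) (auto intro!: integral_nonneg mult_nonneg_nonneg)
  also have "(\<integral>z. \<phi> (norm z) * (1 + g (sgn z)) \<partial>lborel)
     = (\<integral>z. \<phi> (norm (z::'a)) \<partial>lborel) + (\<integral>z. \<phi> (norm z) * g (sgn z) \<partial>lborel)"
    using i1 int by (simp add: algebra_simps)
  also have "(\<integral>y. 1 + g y \<partial>sigma_S) = 1 + (\<integral>y. g y \<partial>sigma_S)"
    using ig sigma.prob_space by simp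
  finally show ?thesis by (simp add: algebra_simps)
qed

section \<open>Moments of the surface measure\<close>

text \<open>If the coefficients first differ at index n, dividing the difference series by x^n
  leaves a series that vanishes off the origin but has the nonzero constant term \<open>c n\<close>.
  This serves to read off moments from two expansions of one generating function.\<close>

lemma powser_coeff_unique:
  fixes a b :: "nat \<Rightarrow> real"
  assumes r: "0 < r"
    and a: "\<And>x. \<bar>x\<bar> < r \<Longrightarrow> (\<lambda>n. a n * x ^ n) sums f x"
    and b: "\<And>x. \<bar>x\<bar> < r \<Longrightarrow> (\<lambda>n. b n * x ^ n) sums f x"
  shows "a = b"
proof (rule ccontr)
  assume "a \<noteq> b"
  define c where "c n = a n - b n" for n
  have c: "(\<lambda>n. c n * x ^ n) sums 0" if "\<bar>x\<bar> < r" for x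
    using sums_diff[OF a[OF that] b[OF that]] by (simp add: c_def algebra_simps)
  have "\<exists>n. c n \<noteq> 0" using \<open>a \<noteq> b\<close> by (auto simp: c_def fun_eq_iff)
  define n where "n = (LEAST n. c n \<noteq> 0)"
  have cn: "c n \<noteq> 0" unfolding n_def using \<open>\<exists>n. c n \<noteq> 0\<close> by (rule LeastI_ex)
  have c0: "c i = 0" if "i < n" for i
    using not_less_Least[of i "\<lambda>n. c n \<noteq> 0"] that by (auto simp: n_def)
  have "(\<lambda>k. c (k + n) * x ^ k) sums 0" if x: "x \<noteq> 0" "norm x < r" for x
  proof -
    have "(\<lambda>k. c (k + n) * x ^ (k + n)) sums (0 - (\<Sum>i<n. c i * x ^ i))"
      using x c[of x] by (intro sums_split_initial_segment) auto
    then have "(\<lambda>k. (c (k + n) * x ^ k) * x ^ n) sums (0 * x ^ n)"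
      using c0 by (simp add: power_add mult_ac)
    then show ?thesis using x by (subst (asm) sums_mult2_iff) auto
  qed
  then have "((\<lambda>_::real. 0::real) \<longlongrightarrow> c (0 + n)) (at 0)"
    by (rule powser_limit_0_strong[OF r])
  then have "c n = 0" by (simp add: tendsto_const_iff)
  with cn show False by simp
qed

text \<open>All partial sums of the exponential series at \<open>g x\<close> are bounded by
  \<open>exp \<bar>g x\<bar>\<close>, so the integrability hypothesis supplies the majorant for
  dominated convergence. With g linear in a parameter, this yields generating functions of
  moments.\<close>

lemma integral_exp_powser:
  fixes g w :: "'a \<Rightarrow> real"
  assumes [measurable]: "g \<in> borel_measurable M" "w \<in> borel_measurable M"
    and w: "\<And>x. 0 \<le> w x" and int: "integrable M (\<lambda>x. exp \<bar>g x\<bar> * w x)"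
  shows "(\<lambda>n. \<integral>x. g x ^ n / fact n * w x \<partial>M) sums (\<integral>x. exp (g x) * w x \<partial>M)"
proof -
  have bnd: "\<bar>\<Sum>i<n. g x ^ i / fact i\<bar> \<le> exp \<bar>g x\<bar>" for x n
  proof -
    have "\<bar>\<Sum>i<n. g x ^ i / fact i\<bar> \<le> (\<Sum>i<n. \<bar>g x\<bar> ^ i / fact i)"
      by (rule order_trans[OF sum_abs]) (simp add: power_abs)
    also have "\<dots> \<le> (\<Sum>i. \<bar>g x\<bar> ^ i / fact i)"
      using summable_exp[of "\<bar>g x\<bar>"] by (intro sum_le_suminf) (auto simp: divide_inverse mult.commute)
    also have "\<dots> = exp \<bar>g x\<bar>" by (simp add: exp_def divide_inverse mult.commute)
    finally show ?thesis .
  qed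
  have int_term: "integrable M (\<lambda>x. g x ^ i / fact i * w x)" for i
  proof (rule Bochner_Integration.integrable_bound[OF int])
    have "\<bar>g x ^ i / fact i\<bar> \<le> exp \<bar>g x\<bar>" for x
    proof -
      have "\<bar>g x\<bar> ^ i / fact i = (\<Sum>j\<in>{i}. \<bar>g x\<bar> ^ j / fact j)" by simp
      also have "\<dots> \<le> (\<Sum>j. \<bar>g x\<bar> ^ j / fact j)"
        using summable_exp[of "\<bar>g x\<bar>"] by (intro sum_le_suminf) (auto simp: divide_inverse mult.commute)
      also have "\<dots> = exp \<bar>g x\<bar>" by (simp add: exp_def divide_inverse mult.commute)
      finally show ?thesis by (simp add: power_abs)
    qed
    then show "AE x in M. norm (g x ^ i / fact i * w x) \<le> norm (exp \<bar>g x\<bar> * w x)"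
      using w by (auto simp only: real_norm_def abs_mult abs_exp_cancel abs_of_nonneg intro!: AE_I2 mult_right_mono)
  qed auto
  have "(\<lambda>n. \<integral>x. (\<Sum>i<n. g x ^ i / fact i) * w x \<partial>M) \<longlonglongrightarrow> (\<integral>x. exp (g x) * w x \<partial>M)"
  proof (rule integral_dominated_convergence[OF _ _ int])
    show "AE x in M. (\<lambda>n. (\<Sum>i<n. g x ^ i / fact i) * w x) \<longlonglongrightarrow> exp (g x) * w x"
      using exp_converges[of "g x" for x]
      by (auto simp: sums_def divide_inverse mult.commute intro!: tendsto_intros)
    show "AE x in M. norm ((\<Sum>i<n. g x ^ i / fact i) * w x) \<le> exp \<bar>g x\<bar> * w x" for n
      using bnd w by (auto simp: abs_mult intro!: mult_right_mono)
  qed auto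
  moreover have "(\<integral>x. (\<Sum>i<n. g x ^ i / fact i) * w x \<partial>M) = (\<Sum>i<n. \<integral>x. g x ^ i / fact i * w x \<partial>M)" for n
    using int_term by (simp add: sum_distrib_right Bochner_Integration.integral_sum)
  ultimately show ?thesis by (simp add: sums_def)
qed

section \<open>Gaussian integrals and their moments\<close>

lemma integrable_gaussian:
  assumes c: "c > 0"
  shows "integrable lborel (\<lambda>z::'a::euclidean_space. exp (- c * (norm z)\<^sup>2))"
proof -
  have 1: "(\<integral>\<^sup>+x. ennreal (exp (- c * x\<^sup>2)) \<partial>lborel) < \<infinity>" (is "?I < _")
  proof -
    have "integrable lborel (\<lambda>x. sqrt (pi / c) * normal_density 0 (sqrt (1 / (2 * c))) x)"
      using c by (intro integrable_mult_right) simp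
    also have "(\<lambda>x. sqrt (pi / c) * normal_density 0 (sqrt (1 / (2 * c))) x) = (\<lambda>x. exp (- c * x\<^sup>2))"
      using c by (auto simp: normal_density_def fun_eq_iff field_simps real_sqrt_divide real_sqrt_mult)
    finally show ?thesis by (simp add: integrable_iff_bounded)
  qed
  have "(\<integral>\<^sup>+z. ennreal (exp (- c * (norm z)\<^sup>2)) \<partial>(lborel::'a measure))
      = (\<integral>\<^sup>+z. (\<Prod>b\<in>Basis. ennreal (exp (- c * (z \<bullet> b)\<^sup>2))) \<partial>(lborel::'a measure))"
  proof (rule nn_integral_cong)
    fix z :: 'a
    have "(norm z)\<^sup>2 = (\<Sum>b\<in>Basis. (z \<bullet> b)\<^sup>2)"
      unfolding power2_norm_eq_inner by (subst euclidean_inner) (simp add: power2_eq_square)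
    then show "ennreal (exp (- c * (norm z)\<^sup>2)) = (\<Prod>b\<in>Basis. ennreal (exp (- c * (z \<bullet> b)\<^sup>2)))"
      by (simp add: prod_ennreal exp_sum[symmetric] sum_distrib_left sum_negf)
  qed
  also have "\<dots> = (\<Prod>b\<in>(Basis :: 'a set). ?I)"
    by (intro nn_integral_lborel_prod) auto
  also have "\<dots> < \<infinity>" using 1 by (simp add: power_less_top_ennreal)
  finally show ?thesis by (simp add: integrable_iff_bounded)
qed

lemma integral_lborel_scaleR:
  fixes f :: "'a::euclidean_space \<Rightarrow> real"
  assumes [measurable]: "f \<in> borel_measurable borel" and c: "c > 0"
  shows "(\<integral>z. f z \<partial>lborel) = c ^ DIM('a) * (\<integral>z. f (c *\<^sub>R z) \<partial>lborel)"
proof -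
  have "(\<integral>z. f z \<partial>lborel)
      = (\<integral>z. f z \<partial>density (distr lborel borel (\<lambda>x. 0 + c *\<^sub>R x)) (\<lambda>_. \<bar>c\<bar>^DIM('a)))"
    using c by (subst lborel_affine[of c 0]) auto
  also have "\<dots> = (\<integral>z. c ^ DIM('a) * f (c *\<^sub>R z) \<partial>lborel)"
    using c by (subst integral_density) (auto simp: integral_distr)
  finally show ?thesis by simp
qed

lemma integral_lborel_translate:
  fixes f :: "'a::euclidean_space \<Rightarrow> real"
  assumes [measurable]: "f \<in> borel_measurable borel"
  shows "(\<integral>z. f z \<partial>lborel) = (\<integral>z. f (t + z) \<partial>lborel)"
  by (subst lborel_distr_plus[of t, symmetric]) (simp add: integral_distr)

text \<open>The Gaussian is left unnormalised: the total mass \<open>gauss_moment _ 0\<close> occurs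
  as a common factor on both sides and cancels. The type argument only records the
  dimension.\<close>

definition gauss_moment :: "'a::euclidean_space itself \<Rightarrow> nat \<Rightarrow> real" where
  "gauss_moment _ n = (\<integral>z. norm z ^ n * exp (- (norm z)\<^sup>2) \<partial>(lborel::'a measure))"

lemma integrable_exp_gaussian:
  fixes g :: "'a::euclidean_space \<Rightarrow> real"
  assumes [measurable]: "g \<in> borel_measurable borel"
    and g: "\<And>z. \<bar>g z\<bar> \<le> A + B * (norm z)\<^sup>2" and B: "B < 1"
  shows "integrable lborel (\<lambda>z. exp \<bar>g z\<bar> * exp (- (norm z)\<^sup>2))"
proof (rule Bochner_Integration.integrable_bound)
  show "integrable lborel (\<lambda>z::'a. exp A * exp (- (1 - B) * (norm z)\<^sup>2))"
    using integrable_gaussian[of "1 - B", where 'a='a] B by (intro integrable_mult_right) auto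
  show "AE z in lborel. norm (exp \<bar>g z\<bar> * exp (- (norm z)\<^sup>2))
           \<le> norm (exp A * exp (- (1 - B) * (norm z)\<^sup>2))"
    using g by (auto simp: exp_add[symmetric] algebra_simps)
qed auto

lemma integrable_gauss_moment:
  "integrable lborel (\<lambda>z::'a::euclidean_space. norm z ^ n * exp (- (norm z)\<^sup>2))"
proof (rule Bochner_Integration.integrable_bound)
  show "integrable lborel (\<lambda>z::'a. fact n * (exp \<bar>norm z\<bar> * exp (- (norm z)\<^sup>2)))"
  proof (intro integrable_mult_right integrable_exp_gaussian[where A=1 and B="1/2"])
    fix z :: 'a
    have "0 \<le> (norm z - 1)\<^sup>2" by simp
    then show "\<bar>norm z\<bar> \<le> 1 + 1/2 * (norm z)\<^sup>2" by (simp add: power2_diff)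
  qed auto
  have "norm z ^ n \<le> fact n * exp (norm z)" for z :: 'a
  proof -
    have "(\<Sum>j\<in>{n}. norm z ^ j / fact j) \<le> (\<Sum>j. norm z ^ j / fact j)"
      using summable_exp[of "norm z"] by (intro sum_le_suminf) (auto simp: divide_inverse mult.commute)
    also have "\<dots> = exp (norm z)" by (simp add: exp_def divide_inverse mult.commute)
    finally show ?thesis by (simp add: field_simps)
  qed
  then show "AE z::'a in lborel. norm (norm z ^ n * exp (- (norm z)\<^sup>2))
      \<le> norm (fact n * (exp \<bar>norm z\<bar> * exp (- (norm z)\<^sup>2)))"
    by (auto simp: abs_mult mult.assoc[symmetric] intro!: mult_right_mono)
qed auto

lemma gauss_moment_pos: "gauss_moment TYPE('a::euclidean_space) n > 0"
proof -
  have "gauss_moment TYPE('a) n \<noteq> 0"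
  proof
    assume "gauss_moment TYPE('a) n = 0"
    then have "AE z in (lborel::'a measure). norm z ^ n * exp (- (norm z)\<^sup>2) = 0"
      using integrable_gauss_moment[of n, where 'a='a]
      by (subst (asm) gauss_moment_def, subst (asm) integral_nonneg_eq_0_iff_AE) auto
    with AE_lborel_singleton[of "0::'a"] have "AE z in (lborel::'a measure). False"
      by eventually_elim auto
    then show False by (simp add: trivial_limit_def[symmetric] ae_filter_eq_bot_iff)
  qed
  moreover have "gauss_moment TYPE('a) n \<ge> 0"
    by (auto simp: gauss_moment_def intro!: integral_nonneg)
  ultimately show ?thesis by linarith
qed

lemma binomial_powr_minus_sums:
  fixes z b :: real
  assumes "\<bar>z\<bar> < 1"
  shows "(\<lambda>n. pochhammer b n / fact n * z ^ n) sums (1 - z) powr (- b)"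
proof -
  have "((- b) gchoose n) * (- z) ^ n = pochhammer b n / fact n * z ^ n" for n
  proof -
    have "((- b) gchoose n) * (- z) ^ n = ((- 1) ^ n * (- 1) ^ n) * (pochhammer b n / fact n * z ^ n)"
      unfolding gbinomial_pochhammer power_minus[of z] by simp
    then show ?thesis by (simp flip: power_mult_distrib)
  qed
  then show ?thesis using gen_binomial_real[of "- z" "- b"] assms by simp
qed

text \<open>The integral of exp (b |z|^2 - |z|^2) is expanded in b in two ways: term by term, and
  after the dilation by (1 - b)^(-1/2), whose Jacobian is (1 - b)^(-d/2) and has a binomial series.
  Comparing coefficients gives the claim.\<close>

lemma gauss_moment_even:
  "gauss_moment TYPE('a::euclidean_space) (2 * k)
     = gauss_moment TYPE('a) 0 * pochhammer (real DIM('a) / 2) k"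
proof -
  let ?W = "gauss_moment TYPE('a)"
  let ?d = "real DIM('a)"
  have 1: "(\<lambda>n. ?W (2 * n) / fact n * b ^ n) sums ((1 - b) powr (- ?d / 2) * ?W 0)" if b: "\<bar>b\<bar> < 1" for b
  proof -
    have "(\<lambda>n. \<integral>z. (b * (norm z)\<^sup>2) ^ n / fact n * exp (- (norm z)\<^sup>2) \<partial>(lborel::'a measure))
        sums (\<integral>z. exp (b * (norm z)\<^sup>2) * exp (- (norm z)\<^sup>2) \<partial>(lborel::'a measure))"
      by (intro integral_exp_powser integrable_exp_gaussian[where A=0 and B="\<bar>b\<bar>"])
         (use b in \<open>auto simp: abs_mult\<close>)
    also have "(\<lambda>n. \<integral>z. (b * (norm z)\<^sup>2) ^ n / fact n * exp (- (norm z)\<^sup>2) \<partial>(lborel::'a measure))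
       = (\<lambda>n. ?W (2 * n) / fact n * b ^ n)"
    proof
      fix n
      have "(\<integral>z. (b * (norm z)\<^sup>2) ^ n / fact n * exp (- (norm z)\<^sup>2) \<partial>(lborel::'a measure))
         = (\<integral>z. (b ^ n / fact n) * (norm z ^ (2 * n) * exp (- (norm z)\<^sup>2)) \<partial>(lborel::'a measure))"
        by (intro Bochner_Integration.integral_cong) (simp_all add: power_mult_distrib power_mult)
      then show "(\<integral>z. (b * (norm z)\<^sup>2) ^ n / fact n * exp (- (norm z)\<^sup>2) \<partial>(lborel::'a measure))
         = ?W (2 * n) / fact n * b ^ n" by (simp add: gauss_moment_def)
    qed
    also have "(\<integral>z. exp (b * (norm z)\<^sup>2) * exp (- (norm z)\<^sup>2) \<partial>(lborel::'a measure))
        = (\<integral>z. exp (- (1 - b) * (norm z)\<^sup>2) \<partial>(lborel::'a measure))"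
      by (simp add: exp_add[symmetric] algebra_simps)
    also have "\<dots> = (1 - b) powr (- ?d / 2) * ?W 0"
    proof -
      let ?c = "(1 - b) powr (- (1/2))"
      have c: "?c > 0" "?c\<^sup>2 = 1 / (1 - b)"
        using b by (auto simp: power2_eq_square powr_add[symmetric] powr_minus_divide)
      have "(\<integral>z. exp (- (1 - b) * (norm z)\<^sup>2) \<partial>(lborel::'a measure))
         = ?c ^ DIM('a) * (\<integral>z. exp (- (1 - b) * (norm (?c *\<^sub>R z))\<^sup>2) \<partial>(lborel::'a measure))"
        by (rule integral_lborel_scaleR) (use c in auto)
      also have "\<dots> = ?c ^ DIM('a) * ?W 0"
      proof -
        have "- (1 - b) * (norm (?c *\<^sub>R z))\<^sup>2 = - (norm z)\<^sup>2" for z :: 'a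
        proof -
          have "(norm (?c *\<^sub>R z))\<^sup>2 = (norm z)\<^sup>2 / (1 - b)"
            using c(2) by (simp add: power_mult_distrib)
          then show ?thesis using b by (simp add: field_simps)
        qed
        then show ?thesis by (simp add: gauss_moment_def)
      qed
      also have "?c ^ DIM('a) = (1 - b) powr (- ?d / 2)"
        using b by (subst powr_realpow[symmetric]) (auto simp: powr_powr)
      finally show ?thesis .
    qed
    finally show ?thesis .
  qed
  have 2: "(\<lambda>n. (?W 0 * pochhammer (?d / 2) n / fact n) * b ^ n) sums ((1 - b) powr (- ?d / 2) * ?W 0)"
    if b: "\<bar>b\<bar> < 1" for b
  proof -
    have "(\<lambda>n. ?W 0 * (pochhammer (?d / 2) n / fact n * b ^ n)) sums (?W 0 * (1 - b) powr (- (?d / 2)))"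
      by (intro sums_mult binomial_powr_minus_sums b)
    then show ?thesis by (simp add: mult_ac)
  qed
  have "(\<lambda>n. ?W (2 * n) / fact n) = (\<lambda>n. ?W 0 * pochhammer (?d / 2) n / fact n)"
    by (rule powser_coeff_unique[of 1]) (use 1 2 in auto)
  from fun_cong[OF this, of k] show ?thesis by simp
qed

text \<open>(z.e)^n is |z|^n times a function of \<open>sgn z\<close>, so the Gaussian integral
  factorises in polar coordinates.\<close>

lemma sigma_moment_gauss:
  fixes e :: "'a::euclidean_space"
  assumes e: "norm e = 1"
  shows "(\<integral>z. (z \<bullet> e) ^ n * exp (- (norm z)\<^sup>2) \<partial>lborel)
           = gauss_moment TYPE('a) n * (\<integral>y. (y \<bullet> e) ^ n \<partial>sigma_S)"
proof -
  have sg: "\<bar>sgn z \<bullet> e\<bar> \<le> 1" for z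
    using Cauchy_Schwarz_ineq2[of "sgn z" e] e by (auto simp: norm_sgn split: if_splits)
  \<comment> \<open>\<open>integral_polar\<close> requires a bound by 1 everywhere, whereas |y.e| <=
    1 is known only on the sphere. Clamping to [-1, 1] changes nothing at values of
    \<open>sgn\<close> and only a null set of \<open>sigma_S\<close>.\<close>
  let ?g = "\<lambda>y. (max (-1) (min 1 (y \<bullet> e))) ^ n"
  have int: "integrable lborel (\<lambda>z::'a. norm z ^ n * exp (- (norm z)\<^sup>2))"
    by (rule integrable_gauss_moment)
  have "(\<integral>z. (z \<bullet> e) ^ n * exp (- (norm z)\<^sup>2) \<partial>lborel)
      = (\<integral>z. (norm z ^ n * exp (- (norm z)\<^sup>2)) * ?g (sgn z) \<partial>lborel)"
  proof (rule Bochner_Integration.integral_cong[OF refl])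
    fix z
    have "max (-1) (min 1 (sgn z \<bullet> e)) = sgn z \<bullet> e" using sg[of z] by (simp add: abs_le_iff)
    moreover have "z \<bullet> e = norm z * (sgn z \<bullet> e)" by (cases "z = 0") (auto simp: sgn_div_norm)
    ultimately show "(z \<bullet> e) ^ n * exp (- (norm z)\<^sup>2) = (norm z ^ n * exp (- (norm z)\<^sup>2)) * ?g (sgn z)"
      by (simp add: power_mult_distrib)
  qed
  also have "\<dots> = (\<integral>z. norm z ^ n * exp (- (norm z)\<^sup>2) \<partial>(lborel::'a measure)) * (\<integral>y. ?g y \<partial>sigma_S)"
    by (rule integral_polar[OF _ _ _ _ int]) (auto simp: power_abs intro!: power_le_one)
  also have "(\<integral>y. ?g y \<partial>sigma_S) = (\<integral>y. (y \<bullet> e) ^ n \<partial>sigma_S)"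
  proof (rule integral_cong_AE)
    show "AE y in sigma_S. ?g y = (y \<bullet> e) ^ n"
      using AE_sigma_S_sphere
    proof eventually_elim
      case (elim y)
      then have "\<bar>y \<bullet> e\<bar> \<le> 1" using Cauchy_Schwarz_ineq2[of y e] e by (simp add: unit_sph_def)
      then show ?case by (simp add: abs_le_iff)
    qed
  qed auto
  finally show ?thesis by (simp add: gauss_moment_def)
qed

text \<open>The generating function is the Gaussian integral of exp (2 a z.e). Translating by a e
  completes the square and leaves exp (a^2) times the total mass; each coefficient in a is, by the
  factorisation above, a radial moment times the wanted moment.\<close>

lemma sigma_moments:
  fixes e :: "'a::euclidean_space"
  assumes e: "norm e = 1"
  shows "(\<integral>y. (y \<bullet> e) ^ (2 * k) \<partial>sigma_S) = pochhammer (1/2) k / pochhammer (real DIM('a) / 2) k"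
    and "odd n \<Longrightarrow> (\<integral>y. (y \<bullet> e) ^ n \<partial>sigma_S) = 0"
proof -
  let ?W = "gauss_moment TYPE('a)"
  define m where "m n = (\<integral>y. (y \<bullet> e) ^ n \<partial>sigma_S)" for n
  \<comment> \<open>Taylor coefficients in a of exp (a^2) times the total mass: only even powers
    occur, and a^(2k) carries 1/k!.\<close>
  define b where "b n = (if even n then ?W 0 / fact (n div 2) else 0)" for n
  have 1: "(\<lambda>n. (2 ^ n / fact n * (?W n * m n)) * a ^ n) sums (exp (a\<^sup>2) * ?W 0)" for a :: real
  proof -
    have "(\<lambda>n. \<integral>z. (2 * a * (z \<bullet> e)) ^ n / fact n * exp (- (norm z)\<^sup>2) \<partial>(lborel::'a measure))
        sums (\<integral>z. exp (2 * a * (z \<bullet> e)) * exp (- (norm z)\<^sup>2) \<partial>(lborel::'a measure))"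
    \<comment> \<open>The weights in 2 |a| |z| <= 2 a^2 + |z|^2 / 2 are chosen so that the
      coefficient of |z|^2 stays below 1 and the Gaussian absorbs it.\<close>
    proof (intro integral_exp_powser integrable_exp_gaussian[where A="2*a\<^sup>2" and B="1/2"])
      fix z :: 'a
      have "\<bar>2 * a * (z \<bullet> e)\<bar> \<le> 2 * \<bar>a\<bar> * norm z"
        using Cauchy_Schwarz_ineq2[of z e] e by (simp add: abs_mult mult_left_mono)
      also have "0 \<le> (2 * \<bar>a\<bar> - norm z)\<^sup>2" by simp
      then have "2 * \<bar>a\<bar> * norm z \<le> 2 * a\<^sup>2 + 1/2 * (norm z)\<^sup>2" by (simp add: power2_diff power_mult_distrib)
      finally show "\<bar>2 * a * (z \<bullet> e)\<bar> \<le> 2 * a\<^sup>2 + 1/2 * (norm z)\<^sup>2" .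
    qed auto
    also have "(\<lambda>n. \<integral>z. (2 * a * (z \<bullet> e)) ^ n / fact n * exp (- (norm z)\<^sup>2) \<partial>(lborel::'a measure))
        = (\<lambda>n. (2 ^ n / fact n * (?W n * m n)) * a ^ n)"
    proof
      fix n
      have "(\<integral>z. (2 * a * (z \<bullet> e)) ^ n / fact n * exp (- (norm z)\<^sup>2) \<partial>(lborel::'a measure))
        = (\<integral>z. (2 ^ n / fact n * a ^ n) * ((z \<bullet> e) ^ n * exp (- (norm z)\<^sup>2)) \<partial>(lborel::'a measure))"
        by (simp add: power_mult_distrib mult_ac)
      then show "(\<integral>z. (2 * a * (z \<bullet> e)) ^ n / fact n * exp (- (norm z)\<^sup>2) \<partial>(lborel::'a measure))
        = (2 ^ n / fact n * (?W n * m n)) * a ^ n"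
        using sigma_moment_gauss[OF e, of n] by (simp add: m_def)
    qed
    also have "(\<integral>z. exp (2 * a * (z \<bullet> e)) * exp (- (norm z)\<^sup>2) \<partial>(lborel::'a measure))
       = (\<integral>z. exp (2 * a * ((a *\<^sub>R e + z) \<bullet> e)) * exp (- (norm (a *\<^sub>R e + z))\<^sup>2) \<partial>(lborel::'a measure))"
      by (rule integral_lborel_translate) auto
    also have "\<dots> = (\<integral>z. exp (a\<^sup>2) * exp (- (norm z)\<^sup>2) \<partial>(lborel::'a measure))"
    proof (rule Bochner_Integration.integral_cong[OF refl])
      fix z :: 'a
      have "(norm (a *\<^sub>R e + z))\<^sup>2 = a\<^sup>2 + 2 * a * (z \<bullet> e) + (norm z)\<^sup>2"
        using e unfolding power2_norm_eq_inner norm_eq_1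
        by (simp add: inner_add_left inner_add_right inner_commute algebra_simps power2_eq_square)
      moreover have "(a *\<^sub>R e + z) \<bullet> e = a + z \<bullet> e" using e by (simp add: inner_add_left norm_eq_1)
      ultimately show "exp (2 * a * ((a *\<^sub>R e + z) \<bullet> e)) * exp (- (norm (a *\<^sub>R e + z))\<^sup>2)
          = exp (a\<^sup>2) * exp (- (norm z)\<^sup>2)"
        by (simp add: exp_add[symmetric] algebra_simps power2_eq_square)
    qed
    also have "\<dots> = exp (a\<^sup>2) * ?W 0" by (simp add: gauss_moment_def)
    finally show ?thesis .
  qed
  have 2: "(\<lambda>n. b n * a ^ n) sums (exp (a\<^sup>2) * ?W 0)" for a :: real
  proof -
    have "(\<lambda>k. (a\<^sup>2) ^ k / fact k * ?W 0) sums (exp (a\<^sup>2) * ?W 0)"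
      using exp_converges[of "a\<^sup>2"] by (intro sums_mult2) (simp add: divide_inverse mult.commute)
    also have "(\<lambda>k. (a\<^sup>2) ^ k / fact k * ?W 0) = (\<lambda>k. b (2 * k) * a ^ (2 * k))"
      by (simp add: b_def power_mult fun_eq_iff)
    finally show ?thesis
      by (subst (asm) sums_mono_reindex[where g="\<lambda>k. 2 * k" and f="\<lambda>n. b n * a ^ n"])
         (auto simp: strict_mono_def b_def elim!: evenE)
  qed
  have "(\<lambda>n. 2 ^ n / fact n * (?W n * m n)) = b"
    by (rule powser_coeff_unique[of 1]) (use 1 2 in auto)
  then have eq: "2 ^ n / fact n * (?W n * m n) = b n" for n by (rule fun_cong)
  have W0: "?W 0 > 0" by (rule gauss_moment_pos)
  have ph: "pochhammer (real DIM('a) / 2) k > 0" by (intro pochhammer_pos) auto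
  have F: "fact (2 * k) = (2 ^ (2 * k) * pochhammer (1/2) k * fact k :: real)"
    by (rule fact_double)
  have q: "pochhammer (1/2 :: real) k > 0" by (intro pochhammer_pos) auto
  have "2 ^ (2 * k) / fact (2 * k) * (?W 0 * pochhammer (real DIM('a) / 2) k * m (2 * k)) = ?W 0 / fact k"
    using eq[of "2 * k"] by (simp add: gauss_moment_even b_def)
  then have "(?W 0 * (pochhammer (real DIM('a) / 2) k * m (2 * k))) / (pochhammer (1/2) k * fact k) = ?W 0 / fact k"
    unfolding F by simp
  then have "pochhammer (real DIM('a) / 2) k * m (2 * k) = pochhammer (1/2) k"
    using W0 q by (simp add: divide_simps)
  then show "(\<integral>y. (y \<bullet> e) ^ (2 * k) \<partial>sigma_S) = pochhammer (1/2) k / pochhammer (real DIM('a) / 2) k"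
    using ph by (simp add: m_def eq_divide_eq mult.commute)
  assume "odd n"
  have "?W n > 0" by (rule gauss_moment_pos)
  with eq[of n] \<open>odd n\<close> show "(\<integral>y. (y \<bullet> e) ^ n \<partial>sigma_S) = 0"
    by (simp add: b_def m_def)
qed

section \<open>The potential of the surface measure\<close>

text \<open>From some index on, |b k - L c k| is at most epsilon/2 times \<open>c k\<close>. After
  multiplication by (1 - Q)^a that tail costs at most epsilon/2, because the series of c sums to
  exactly (1 - Q)^(-a). The finite head stays bounded and is killed by (1 - Q)^a, as a > 0.\<close>

lemma abelian_ratio:
  fixes b c :: "nat \<Rightarrow> real"
  assumes c: "\<And>k. 0 < c k" and ratio: "(\<lambda>k. b k / c k) \<longlonglongrightarrow> L" and a: "a > 0"
    and csum: "\<And>Q. 0 \<le> Q \<Longrightarrow> Q < 1 \<Longrightarrow> (\<lambda>k. c k * Q ^ k) sums (1 - Q) powr (- a)"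
    and bsum: "\<And>Q. 0 \<le> Q \<Longrightarrow> Q < 1 \<Longrightarrow> (\<lambda>k. b k * Q ^ k) sums B Q"
  shows "((\<lambda>Q. (1 - Q) powr a * B Q) \<longlongrightarrow> L) (at_left 1)"
proof (rule tendstoI)
  fix \<epsilon> :: real assume \<epsilon>: "\<epsilon> > 0"
  define D where "D k = b k - L * c k" for k
  from \<epsilon> obtain N where N: "\<And>k. k \<ge> N \<Longrightarrow> \<bar>b k / c k - L\<bar> < \<epsilon> / 2"
    using LIMSEQ_D[OF ratio, of "\<epsilon> / 2"] by auto
  have D: "\<bar>D k\<bar> \<le> \<epsilon> / 2 * c k" if "k \<ge> N" for k
  proof -
    have "\<bar>D k\<bar> = \<bar>b k / c k - L\<bar> * c k"
      using c[of k] by (simp add: D_def abs_mult[of _ "c k", symmetric] abs_if field_simps)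
    then show ?thesis using N[OF that] c[of k] by (simp add: mult_right_mono)
  qed
  define C where "C = (\<Sum>k<N. \<bar>D k\<bar>)"
  have key: "\<bar>(1 - Q) powr a * B Q - L\<bar> \<le> C * (1 - Q) powr a + \<epsilon> / 2" if Q: "0 \<le> Q" "Q < 1" for Q
  proof -
    let ?P = "(1 - Q) powr (- a)"
    have s1: "(\<lambda>k. D k * Q ^ k) sums (B Q - L * ?P)"
      using sums_diff[OF bsum[OF Q] sums_mult[OF csum[OF Q], of L]] by (simp add: D_def algebra_simps)
    have "(\<lambda>k. if k \<in> {..<N} then \<bar>D k\<bar> else 0) sums (\<Sum>k\<in>{..<N}. \<bar>D k\<bar>)"
      by (rule sums_If_finite_set) simp
    then have s2: "(\<lambda>k. (if k \<in> {..<N} then \<bar>D k\<bar> else 0) + \<epsilon> / 2 * (c k * Q ^ k)) sums (C + \<epsilon> / 2 * ?P)"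
      unfolding C_def by (intro sums_add sums_mult csum Q)
    have le: "\<bar>D k * Q ^ k\<bar> \<le> (if k \<in> {..<N} then \<bar>D k\<bar> else 0) + \<epsilon> / 2 * (c k * Q ^ k)" for k
    proof (cases "k < N")
      case True
      have "\<bar>D k\<bar> * Q ^ k \<le> \<bar>D k\<bar>" using Q by (intro mult_left_le power_le_one) auto
      moreover have "0 \<le> \<epsilon> / 2 * (c k * Q ^ k)" using Q c[of k] \<epsilon> by auto
      ultimately show ?thesis using True Q by (simp add: abs_mult)
    next
      case False
      then have "\<bar>D k\<bar> * Q ^ k \<le> \<epsilon> / 2 * c k * Q ^ k" using D[of k] Q by (intro mult_right_mono) auto
      then show ?thesis using False Q by (simp add: abs_mult)
    qed
    have "B Q - L * ?P \<le> C + \<epsilon> / 2 * ?P"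
      by (rule sums_le[OF _ s1 s2]) (use le in \<open>force simp: abs_le_iff\<close>)
    moreover have "- (B Q - L * ?P) \<le> C + \<epsilon> / 2 * ?P"
      by (rule sums_le[OF _ sums_minus[OF s1] s2]) (use le in \<open>force simp: abs_le_iff\<close>)
    ultimately have "\<bar>B Q - L * ?P\<bar> \<le> C + \<epsilon> / 2 * ?P" by linarith
    then have "(1 - Q) powr a * \<bar>B Q - L * ?P\<bar> \<le> (1 - Q) powr a * (C + \<epsilon> / 2 * ?P)"
      by (rule mult_left_mono) simp
    moreover have "(1 - Q) powr a * ?P = 1" using Q by (simp add: powr_add[symmetric])
    moreover have "(1 - Q) powr a * \<bar>B Q - L * ?P\<bar> = \<bar>(1 - Q) powr a * B Q - L * ((1 - Q) powr a * ?P)\<bar>"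
    proof -
      have "(1 - Q) powr a * \<bar>B Q - L * ?P\<bar> = \<bar>(1 - Q) powr a * (B Q - L * ?P)\<bar>"
        by (simp add: abs_mult)
      then show ?thesis by (simp add: algebra_simps)
    qed
    ultimately show ?thesis by (simp add: algebra_simps)
  qed
  have "((\<lambda>Q. C * (1 - Q) powr a) \<longlongrightarrow> C * (1 - 1) powr a) (at_left (1::real))"
    using a by (intro tendsto_mult tendsto_const tendsto_powr' tendsto_intros) (auto simp: eventually_at_filter)
  then have "((\<lambda>Q. C * (1 - Q) powr a) \<longlongrightarrow> 0) (at_left (1::real))" by simp
  then have "\<forall>\<^sub>F Q in at_left 1. C * (1 - Q) powr a < \<epsilon> / 2"
    using \<epsilon> by (intro order_tendstoD(2)) auto
  moreover have "\<forall>\<^sub>F Q in at_left (1::real). Q \<in> {0<..<1}"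
    by (rule eventually_at_left_real) simp
  ultimately show "\<forall>\<^sub>F Q in at_left 1. dist ((1 - Q) powr a * B Q) L < \<epsilon>"
  proof eventually_elim
    case (elim Q)
    with key[of Q] show ?case by (auto simp: dist_real_def)
  qed
qed

text \<open>By the Gamma limit formula, \<open>pochhammer x k\<close> behaves like k^x (k-1)! /
  Gamma x. Equal parameter sums make the powers of k and the factorials cancel, and only the Gamma
  values survive.\<close>

lemma pochhammer_ratio_tendsto:
  fixes x y u v :: real
  assumes pos: "x > 0" "y > 0" "u > 0" "v > 0" and eq: "x + y = u + v"
  shows "(\<lambda>k. pochhammer x k * pochhammer y k / (pochhammer u k * pochhammer v k))
           \<longlonglongrightarrow> Gamma u * Gamma v / (Gamma x * Gamma y)"
proof (rule Lim_transform_eventually)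
  show "(\<lambda>k. Gamma_series' u k * Gamma_series' v k / (Gamma_series' x k * Gamma_series' y k))
      \<longlonglongrightarrow> Gamma u * Gamma v / (Gamma x * Gamma y)"
    using Gamma_real_pos[OF pos(1)] Gamma_real_pos[OF pos(2)]
    by (intro tendsto_intros Gamma_series'_LIMSEQ) auto
  show "\<forall>\<^sub>F k in sequentially. Gamma_series' u k * Gamma_series' v k / (Gamma_series' x k * Gamma_series' y k)
      = pochhammer x k * pochhammer y k / (pochhammer u k * pochhammer v k)"
  proof (rule always_eventually, rule allI)
    fix k
    define l where "l = ln (real k)"
    have E: "exp (u * l) * exp (v * l) = exp (x * l) * exp (y * l)"
      using eq by (simp add: exp_add[symmetric] distrib_right[symmetric])
    have P: "pochhammer x k > 0" "pochhammer y k > 0" "pochhammer u k > 0" "pochhammer v k > 0"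
      using pos by (auto intro: pochhammer_pos)
    have "Gamma_series' u k * Gamma_series' v k / (Gamma_series' x k * Gamma_series' y k)
       = (fact (k - 1))\<^sup>2 * (exp (u * l) * exp (v * l)) / (pochhammer u k * pochhammer v k)
         / ((fact (k - 1))\<^sup>2 * (exp (x * l) * exp (y * l)) / (pochhammer x k * pochhammer y k))"
      by (simp add: Gamma_series'_def l_def power2_eq_square mult_ac)
    also have "\<dots> = pochhammer x k * pochhammer y k / (pochhammer u k * pochhammer v k)"
      unfolding E using P by (simp add: field_simps)
    finally show "Gamma_series' u k * Gamma_series' v k / (Gamma_series' x k * Gamma_series' y k)
      = pochhammer x k * pochhammer y k / (pochhammer u k * pochhammer v k)" .
  qed
qed

text \<open>The binomial series is integrated term by term, with majorant
  \<open>pochhammer b n / fact n * q ^ n\<close>. Odd moments vanish; for the even ones the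
  duplication formulas for \<open>pochhammer b (2 * k)\<close> and (2k)! cancel the powers of 2. The
  result is the hypergeometric series 2F1(b/2, b/2 + 1/2; d/2; q^2), in particular independent of
  the direction e.\<close>

lemma integral_sigma_binomial:
  fixes e :: "'a::euclidean_space"
  assumes e: "norm e = 1" and q: "0 \<le> q" "q < 1" and b: "b > 0"
  shows "(\<lambda>k. pochhammer (b/2) k * pochhammer (b/2 + 1/2) k / (pochhammer (real DIM('a) / 2) k * fact k) * (q\<^sup>2) ^ k)
            sums (\<integral>y. (1 - q * (y \<bullet> e)) powr (- b) \<partial>sigma_S)"
proof -
  interpret sigma: prob_space "sigma_S :: 'a measure" by (rule prob_space_sigma_S)
  let ?c = "\<lambda>n. pochhammer b n / fact n"
  let ?f = "\<lambda>n y. ?c n * q ^ n * (y \<bullet> e) ^ n"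
  have c0: "?c n \<ge> 0" for n using b by (auto intro!: divide_nonneg_pos pochhammer_nonneg)
  have AEb: "AE y in sigma_S. \<bar>y \<bullet> e\<bar> \<le> 1"
    using AE_sigma_S_sphere
  proof eventually_elim
    case (elim y)
    then show ?case using Cauchy_Schwarz_ineq2[of y e] e by (simp add: unit_sph_def)
  qed
  have bnd: "AE y in sigma_S. norm (?f n y) \<le> ?c n * q ^ n" for n
    using AEb
  proof eventually_elim
    case (elim y)
    then have "\<bar>(y \<bullet> e) ^ n\<bar> \<le> 1" by (simp add: power_abs power_le_one)
    then have "(?c n * q ^ n) * \<bar>(y \<bullet> e) ^ n\<bar> \<le> (?c n * q ^ n) * 1"
      using c0[of n] q by (intro mult_left_mono mult_nonneg_nonneg zero_le_power) auto
    moreover have "\<bar>?c n * q ^ n\<bar> = ?c n * q ^ n"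
      by (rule abs_of_nonneg) (use c0[of n] q in \<open>intro mult_nonneg_nonneg zero_le_power; simp\<close>)
    ultimately show ?case unfolding real_norm_def abs_mult[of "?c n * q ^ n"] by simp
  qed
  have int: "integrable sigma_S (?f n)" for n
    by (rule sigma.integrable_const_bound[OF bnd]) auto
  have sq: "summable (\<lambda>n. ?c n * q ^ n)"
    using binomial_powr_minus_sums[of q b] q by (auto intro: sums_summable)
  have "(\<lambda>n. \<integral>y. ?f n y \<partial>sigma_S) sums (\<integral>y. (\<Sum>n. ?f n y) \<partial>sigma_S)"
  proof (rule sums_integral[OF int])
    show "AE y in sigma_S. summable (\<lambda>n. norm (?f n y))"
      using AE_all_countable[of "\<lambda>n y. norm (?f n y) \<le> ?c n * q ^ n" sigma_S] bnd
      by (auto elim!: eventually_mono intro!: summable_comparison_test[OF _ sq])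
    have "(\<integral>y. norm (?f n y) \<partial>sigma_S) \<le> (\<integral>y. ?c n * q ^ n \<partial>(sigma_S :: 'a measure))" for n
      by (rule integral_mono_AE[OF integrable_norm[OF int[of n]] _ bnd[of n]]) simp
    then have "norm (\<integral>y. norm (?f n y) \<partial>sigma_S) \<le> ?c n * q ^ n" for n
      using sigma.prob_space by simp
    then show "summable (\<lambda>n. \<integral>y. norm (?f n y) \<partial>sigma_S)"
      by (intro summable_comparison_test[OF _ sq]) auto
  qed
  also have "(\<integral>y. (\<Sum>n. ?f n y) \<partial>sigma_S) = (\<integral>y. (1 - q * (y \<bullet> e)) powr (- b) \<partial>sigma_S)"
  proof (rule integral_cong_AE)
    show "AE y in sigma_S. (\<Sum>n. ?f n y) = (1 - q * (y \<bullet> e)) powr (- b)"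
      using AEb
    proof eventually_elim
      case (elim y)
      have "\<bar>q * (y \<bullet> e)\<bar> \<le> q * 1" using q elim by (auto simp: abs_mult intro!: mult_left_le)
      then have "\<bar>q * (y \<bullet> e)\<bar> < 1" using q by linarith
      from sums_unique[OF binomial_powr_minus_sums[OF this, of b]]
      show ?case by (simp add: power_mult_distrib mult_ac)
    qed
  qed auto
  also have "(\<lambda>n. \<integral>y. ?f n y \<partial>sigma_S) = (\<lambda>n. ?c n * q ^ n * (\<integral>y. (y \<bullet> e) ^ n \<partial>sigma_S))"
    by simp
  finally have "(\<lambda>n. ?c n * q ^ n * (\<integral>y. (y \<bullet> e) ^ n \<partial>sigma_S)) sums (\<integral>y. (1 - q * (y \<bullet> e)) powr (- b) \<partial>sigma_S)" .
  then have "(\<lambda>k. ?c (2*k) * q ^ (2*k) * (\<integral>y. (y \<bullet> e) ^ (2*k) \<partial>sigma_S)) sums (\<integral>y. (1 - q * (y \<bullet> e)) powr (- b) \<partial>sigma_S)"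
  proof (subst sums_mono_reindex[where g="\<lambda>k. 2 * k" and f="\<lambda>n. ?c n * q ^ n * (\<integral>y. (y \<bullet> e) ^ n \<partial>sigma_S)"])
    fix n :: nat assume "n \<notin> range (\<lambda>k. 2 * k)"
    then have "odd n" by (auto elim!: evenE)
    then show "?c n * q ^ n * (\<integral>y. (y \<bullet> e) ^ n \<partial>sigma_S) = 0"
      by (simp add: sigma_moments(2)[OF e])
  qed (auto simp: strict_mono_def)
  also have "(\<lambda>k. ?c (2*k) * q ^ (2*k) * (\<integral>y. (y \<bullet> e) ^ (2*k) \<partial>sigma_S))
     = (\<lambda>k. pochhammer (b/2) k * pochhammer (b/2 + 1/2) k / (pochhammer (real DIM('a) / 2) k * fact k) * (q\<^sup>2) ^ k)"
  proof
    fix k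
    have 1: "pochhammer b (2 * k) = 2 ^ (2 * k) * pochhammer (b/2) k * pochhammer (b/2 + 1/2) k"
      using pochhammer_double[of "b/2" k] by simp
    have 2: "fact (2 * k) = (2 ^ (2 * k) * pochhammer (1/2) k * fact k :: real)"
      by (rule fact_double)
    have "pochhammer (1/2 :: real) k > 0" by (intro pochhammer_pos) auto
    then show "?c (2*k) * q ^ (2*k) * (\<integral>y. (y \<bullet> e) ^ (2*k) \<partial>sigma_S)
     = pochhammer (b/2) k * pochhammer (b/2 + 1/2) k / (pochhammer (real DIM('a) / 2) k * fact k) * (q\<^sup>2) ^ k"
      unfolding 1 2 sigma_moments(1)[OF e] by (simp add: power_mult)
  qed
  finally show ?thesis .
qed

lemma power2_powr_half:
  fixes u :: real
  assumes "0 \<le> u"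
  shows "(u\<^sup>2) powr (s / 2) = u powr s"
proof (cases "u = 0")
  case False
  then have "u\<^sup>2 = u powr 2" using assms by simp
  then show ?thesis by (simp only: powr_powr) simp
qed simp

lemma Gamma_legendre_duplication_real:
  fixes z :: real
  assumes "z > 0"
  shows "Gamma z * Gamma (z + 1/2) = 2 powr (1 - 2 * z) * sqrt pi * Gamma (2 * z)"
proof -
  have nz: "complex_of_real x \<notin> \<int>\<^sub>\<le>\<^sub>0" if "x > 0" for x
    using that by (auto elim!: nonpos_Ints_cases simp: complex_eq_iff)
  have "complex_of_real (Gamma z * Gamma (z + 1/2)) = Gamma (of_real z) * Gamma (of_real z + 1/2)"
    by (simp add: Gamma_complex_of_real[symmetric])
  also have "\<dots> = exp ((1 - 2 * of_real z) * of_real (ln 2)) * of_real (sqrt pi) * Gamma (2 * of_real z)"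
    using nz[of z] nz[of "z + 1/2"] assms by (intro Gamma_legendre_duplication) auto
  also have "\<dots> = complex_of_real (exp ((1 - 2 * z) * ln 2) * sqrt pi * Gamma (2 * z))"
    by (simp add: Gamma_complex_of_real[symmetric] exp_of_real[symmetric])
  finally show ?thesis unfolding of_real_eq_iff by (simp add: powr_def mult.commute)
qed

text \<open>Off the sphere and the origin, the integral is
  \<open>K * (1 + (norm x)\<^sup>2) powr (\<alpha> - 1 - s/2)\<close>, continuous at y, times (1 -
  Q)^a B(Q), to which the Abelian lemma applies. \<open>C2\<close> is precisely the constant that
  makes the product of the two limits 1.\<close>

lemma PD_sigma_tendsto_1:
  fixes y :: "'a::euclidean_space"
  assumes d: "DIM('a) \<ge> 2" and \<alpha>: "1 < \<alpha>" and y: "y \<in> unit_sph"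
  shows "((\<lambda>x. \<integral>z. PD \<alpha> x z \<partial>sigma_S) \<longlongrightarrow> 1) (at y within domD)"
proof -
  \<comment> \<open>s is the exponent of |x - z|. As |x - z|^2 is what is linear in z.e, the
    binomial exponent is s/2, and its series has parameters s/4 and s/4 + 1/2. Likewise a is half of
    \<alpha> - 1 because 1 - Q will be a square.\<close>
  define s where "s = real DIM('a) + \<alpha> - 2"
  define a where "a = (\<alpha> - 1) / 2"
  define K where "K = C2 DIM('a) \<alpha> / Gamma (real DIM('a) / 2)"
  define b where "b k = pochhammer (s/4) k * pochhammer (s/4 + 1/2) k / (pochhammer (real DIM('a) / 2) k * fact k)" for k
  define c where "c k = pochhammer a k / fact k" for k
  define L where "L = Gamma (real DIM('a) / 2) * Gamma a / (Gamma (s/4) * Gamma (s/4 + 1/2))"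
  define B where "B Q = (\<Sum>k. b k * Q ^ k)" for Q
  have s: "s > 0" using d \<alpha> by (simp add: s_def)
  have a: "a > 0" using \<alpha> by (simp add: a_def)
  \<comment> \<open>An auxiliary direction: it only witnesses that the series B converges. The sum
    does not depend on it, so a single function B of Q serves every x.\<close>
  obtain e :: 'a where e: "norm e = 1" using y by (auto simp: unit_sph_def)
  have Bsum: "(\<lambda>k. b k * Q ^ k) sums B Q" if "0 \<le> Q" "Q < 1" for Q
  proof -
    have "(\<lambda>k. b k * ((sqrt Q)\<^sup>2) ^ k) sums (\<integral>y. (1 - sqrt Q * (y \<bullet> e)) powr (- (s/2)) \<partial>sigma_S)"
      unfolding b_def using integral_sigma_binomial[OF e, of "sqrt Q" "s/2"] that s by simp
    then show ?thesis using that unfolding B_def by (auto intro: summable_sums sums_summable)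
  qed
  have csum: "(\<lambda>k. c k * Q ^ k) sums (1 - Q) powr (- a)" if "0 \<le> Q" "Q < 1" for Q
    unfolding c_def by (rule binomial_powr_minus_sums) (use that in auto)
  \<comment> \<open>The parameter sums balance: s/4 + (s/4 + 1/2) = d/2 + a, by the choice of s and
    a.\<close>
  have ratio: "(\<lambda>k. b k / c k) \<longlonglongrightarrow> L"
  proof -
    have "(\<lambda>k. b k / c k) = (\<lambda>k. pochhammer (s/4) k * pochhammer (s/4 + 1/2) k / (pochhammer (real DIM('a) / 2) k * pochhammer a k))"
      by (simp add: b_def c_def fun_eq_iff)
    moreover have "\<dots> \<longlonglongrightarrow> L"
      unfolding L_def by (rule pochhammer_ratio_tendsto) (use s a in \<open>auto simp: s_def a_def field_simps\<close>)
    ultimately show ?thesis by simp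
  qed
  have lim: "((\<lambda>Q. (1 - Q) powr a * B Q) \<longlongrightarrow> L) (at_left 1)"
    by (rule abelian_ratio[OF _ ratio a csum Bsum]) (use a in \<open>auto simp: c_def intro!: divide_pos_pos pochhammer_pos\<close>)
  define Q where "Q x = (2 * norm x / (1 + (norm x)\<^sup>2))\<^sup>2" for x :: 'a
  have Q1: "1 - Q x = (\<bar>(norm x)\<^sup>2 - 1\<bar> / (1 + (norm x)\<^sup>2))\<^sup>2" for x :: 'a
  proof -
    define t where "t = (norm x)\<^sup>2"
    have "1 + t > 0" unfolding t_def by (rule add_pos_nonneg) auto
    then have t: "(1 + t)\<^sup>2 > 0" by simp
    have "Q x = 4 * t / (1 + t)\<^sup>2" by (simp add: Q_def t_def power_divide power_mult_distrib)
    then have "1 - Q x = ((1 + t)\<^sup>2 - 4 * t) / (1 + t)\<^sup>2" using t by (simp add: diff_divide_distrib)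
    also have "(1 + t)\<^sup>2 - 4 * t = (t - 1)\<^sup>2" by (simp add: power2_eq_square algebra_simps)
    finally show ?thesis by (simp add: t_def power_divide)
  qed
  have Qlt: "Q x < 1" if "x \<in> domD" for x :: 'a
  proof -
    have "norm x \<noteq> 1" using that by (auto simp: domD_def unit_sph_def)
    then have "(norm x)\<^sup>2 \<noteq> 1" by (simp add: power2_eq_1_iff) (smt (verit) norm_ge_zero)
    moreover have "1 + (norm x)\<^sup>2 > 0" by (simp add: add_pos_nonneg)
    ultimately have "0 < (\<bar>(norm x)\<^sup>2 - 1\<bar> / (1 + (norm x)\<^sup>2))\<^sup>2" by simp
    then show ?thesis using Q1[of x] by linarith
  qed
  have ny: "norm y = 1" using y by (simp add: unit_sph_def)
  have "isCont Q y" unfolding Q_def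
    by (intro continuous_intros) (auto simp: add_nonneg_eq_0_iff)
  then have "(Q \<longlongrightarrow> 1) (at y within domD)"
    using ny by (auto simp: isCont_def Q_def intro: tendsto_within_subset)
  then have "filterlim Q (at_left 1) (at y within domD)"
    by (intro filterlim_at_withinI) (use Qlt in \<open>auto simp: eventually_at_filter\<close>)
  from filterlim_compose[OF lim this]
  have l1: "((\<lambda>x. (1 - Q x) powr a * B (Q x)) \<longlongrightarrow> L) (at y within domD)" .
  have l2: "((\<lambda>x. K * (1 + (norm x)\<^sup>2) powr (\<alpha> - 1 - s/2) * ((1 - Q x) powr a * B (Q x))) \<longlongrightarrow>
      K * (1 + (norm y)\<^sup>2) powr (\<alpha> - 1 - s/2) * L) (at y within domD)"
    by (intro tendsto_mult l1 tendsto_intros) (auto simp: add_nonneg_eq_0_iff)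
  have "K * (1 + (norm y)\<^sup>2) powr (\<alpha> - 1 - s/2) * L = 1"
  proof -
    have G: "Gamma (real DIM('a) / 2) > 0" "Gamma a > 0" "Gamma (s / 2) > 0"
      using d a s by (auto intro!: Gamma_real_pos)
    \<comment> \<open>s/2 equals (\<alpha> + d)/2 - 1, the Gamma argument in the numerator of
      \<open>C2\<close>. Duplication at s/4 therefore cancels that factor, and the powers of 2 on
      both sides have exponent 1 - s/2.\<close>
    have dup: "Gamma (s/4) * Gamma (s/4 + 1/2) = 2 powr (1 - s/2) * sqrt pi * Gamma (s/2)"
      using Gamma_legendre_duplication_real[of "s/4"] s by simp
    have K: "K = sqrt pi * 2 powr (2 - \<alpha>) * Gamma (s/2) / (Gamma a * Gamma (real DIM('a) / 2))"
      by (simp add: K_def C2_def a_def s_def field_simps)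
    have "2 powr (2 - \<alpha>) * 2 powr (\<alpha> - 1 - s/2) = 2 powr (1 - s/2)"
      by (simp add: powr_add[symmetric])
    then have "K * 2 powr (\<alpha> - 1 - s/2)
       = sqrt pi * 2 powr (1 - s/2) * Gamma (s/2) / (Gamma a * Gamma (real DIM('a) / 2))"
      unfolding K by (simp add: mult_ac)
    moreover have "Gamma (real DIM('a) / 2) \<noteq> 0" "Gamma a \<noteq> 0" "Gamma (s / 2) \<noteq> 0"
      using G by linarith+
    ultimately show ?thesis unfolding L_def dup ny by simp
  qed
  with l2 have l3: "((\<lambda>x. K * (1 + (norm x)\<^sup>2) powr (\<alpha> - 1 - s/2) * ((1 - Q x) powr a * B (Q x))) \<longlongrightarrow> 1) (at y within domD)"
    by simp
  have PD_eq: "K * (1 + (norm x)\<^sup>2) powr (\<alpha> - 1 - s/2) * ((1 - Q x) powr a * B (Q x)) = (\<integral>z. PD \<alpha> x z \<partial>sigma_S)"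
    if x: "x \<in> domD" "x \<noteq> 0" for x
  proof -
    define r where "r = norm x"
    define q where "q = 2 * r / (1 + r\<^sup>2)"
    have r: "r > 0" using x by (simp add: r_def)
    have r2: "1 + r\<^sup>2 > 0" by (simp add: add_pos_nonneg)
    have "q\<^sup>2 < 1\<^sup>2" using Qlt[OF x(1)] by (simp add: Q_def q_def r_def)
    then have q: "0 \<le> q" "q < 1" using r r2 power2_less_imp_less[of q 1] by (auto simp: q_def)
    have ne: "norm (sgn x) = 1" using x by (simp add: norm_sgn)
    have "(\<lambda>k. b k * (q\<^sup>2) ^ k) sums (\<integral>z. (1 - q * (z \<bullet> sgn x)) powr (- (s/2)) \<partial>sigma_S)"
      unfolding b_def using integral_sigma_binomial[OF ne q, of "s/2"] s by simp
    then have BQ: "B (Q x) = (\<integral>z. (1 - q * (z \<bullet> sgn x)) powr (- (s/2)) \<partial>sigma_S)"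
      unfolding B_def Q_def q_def r_def by (rule sums_unique[symmetric])
    have PDz: "PD \<alpha> x z = (K * \<bar>r\<^sup>2 - 1\<bar> powr (\<alpha> - 1) * (1 + r\<^sup>2) powr (- (s/2))) * (1 - q * (z \<bullet> sgn x)) powr (- (s/2))"
      if z: "z \<in> unit_sph" for z
    proof -
      have nz: "norm z = 1" using z by (simp add: unit_sph_def)
      have "\<bar>q * (z \<bullet> sgn x)\<bar> \<le> q * 1"
        using Cauchy_Schwarz_ineq2[of z "sgn x"] nz ne q by (auto simp: abs_mult intro!: mult_left_le)
      then have pos: "1 - q * (z \<bullet> sgn x) > 0" using q by linarith
      have "x \<bullet> z = r * (z \<bullet> sgn x)" using x by (simp add: r_def sgn_div_norm inner_commute)
      then have "(norm (x - z))\<^sup>2 = r\<^sup>2 + 1 - 2 * r * (z \<bullet> sgn x)"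
        using nz by (simp add: r_def power2_norm_eq_inner inner_diff_left inner_diff_right inner_commute norm_eq_1)
      also have "\<dots> = (1 + r\<^sup>2) * (1 - q * (z \<bullet> sgn x))"
        using r2 by (simp add: q_def field_simps)
      finally have n2: "(norm (x - z))\<^sup>2 = (1 + r\<^sup>2) * (1 - q * (z \<bullet> sgn x))" .
      have "norm (x - z) powr s = ((norm (x - z))\<^sup>2) powr (s/2)"
        by (simp add: power2_powr_half)
      also have "\<dots> = (1 + r\<^sup>2) powr (s/2) * (1 - q * (z \<bullet> sgn x)) powr (s/2)"
        unfolding n2 using r2 pos by (simp add: powr_mult)
      finally have n3: "norm (x - z) powr s = (1 + r\<^sup>2) powr (s/2) * (1 - q * (z \<bullet> sgn x)) powr (s/2)" .
      have "PD \<alpha> x z = K * (\<bar>r\<^sup>2 - 1\<bar> powr (\<alpha> - 1) / norm (x - z) powr s)"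
        unfolding PD_def K_def s_def r_def ..
      then show ?thesis
        by (simp only: n3 powr_minus divide_inverse inverse_mult_distrib mult_ac)
    qed
    have "(\<integral>z. PD \<alpha> x z \<partial>sigma_S) = (\<integral>z. (K * \<bar>r\<^sup>2 - 1\<bar> powr (\<alpha> - 1) * (1 + r\<^sup>2) powr (- (s/2))) * (1 - q * (z \<bullet> sgn x)) powr (- (s/2)) \<partial>sigma_S)"
    proof (rule integral_cong_AE)
      show "AE z in sigma_S. PD \<alpha> x z = (K * \<bar>r\<^sup>2 - 1\<bar> powr (\<alpha> - 1) * (1 + r\<^sup>2) powr (- (s/2))) * (1 - q * (z \<bullet> sgn x)) powr (- (s/2))"
        using AE_sigma_S_sphere by eventually_elim (rule PDz)
    qed (auto simp: PD_def)
    also have "\<dots> = K * (\<bar>r\<^sup>2 - 1\<bar> powr (\<alpha> - 1) * (1 + r\<^sup>2) powr (- (s/2))) * B (Q x)"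
      by (simp add: BQ)
    also have "\<bar>r\<^sup>2 - 1\<bar> powr (\<alpha> - 1) * (1 + r\<^sup>2) powr (- (s/2)) = (1 + r\<^sup>2) powr (\<alpha> - 1 - s/2) * (1 - Q x) powr a"
    proof -
      have "(1 - Q x) powr a = (\<bar>r\<^sup>2 - 1\<bar> / (1 + r\<^sup>2)) powr (\<alpha> - 1)"
        unfolding Q1 r_def[symmetric] unfolding a_def using r2 by (subst power2_powr_half) auto
      also have "\<dots> = \<bar>r\<^sup>2 - 1\<bar> powr (\<alpha> - 1) / (1 + r\<^sup>2) powr (\<alpha> - 1)"
        using r2 by (simp add: powr_divide)
      finally have "(1 - Q x) powr a = \<bar>r\<^sup>2 - 1\<bar> powr (\<alpha> - 1) / (1 + r\<^sup>2) powr (\<alpha> - 1)" .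
      moreover have "(1 + r\<^sup>2) powr (\<alpha> - 1 - s/2) = (1 + r\<^sup>2) powr (\<alpha> - 1) * (1 + r\<^sup>2) powr (- (s/2))"
        by (simp add: powr_add[symmetric])
      moreover have "(1 + r\<^sup>2) powr (\<alpha> - 1) > 0" using r2 by simp
      ultimately show ?thesis by simp
    qed
    finally show ?thesis by (simp add: r_def mult_ac)
  qed
  \<comment> \<open>The formula uses the unit vector \<open>sgn x\<close>, so the origin is
    excluded; near y this removes nothing.\<close>
  have "y \<noteq> 0" using ny by auto
  then have "\<forall>\<^sub>F x in at y within domD. x \<noteq> 0"
    using tendsto_imp_eventually_ne[OF tendsto_ident_at] by blast
  moreover have "\<forall>\<^sub>F x in at y within domD. x \<in> domD" by (simp add: eventually_at_filter)
  ultimately have "\<forall>\<^sub>F x in at y within domD. K * (1 + (norm x)\<^sup>2) powr (\<alpha> - 1 - s/2) * ((1 - Q x) powr a * B (Q x)) = (\<integral>z. PD \<alpha> x z \<partial>sigma_S)"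
    by eventually_elim (rule PD_eq)
  with l3 show ?thesis by (rule Lim_transform_eventually)
qed

section \<open>Maximal function and kernel estimates\<close>

text \<open>The cone over the ball, truncated to radii in [1 - r, 1), lies in a ball of radius 2 r.\<close>

lemma measure_sigma_S_cball_le:
  fixes y :: "'a::euclidean_space"
  assumes y: "y \<in> unit_sph" and r: "r > 0"
  shows "measure sigma_S (cball y r) \<le> 2 ^ DIM('a) * r ^ (DIM('a) - 1)"
proof (cases "r < 1")
  case False
  interpret sigma: prob_space "sigma_S :: 'a measure" by (rule prob_space_sigma_S)
  have "measure sigma_S (cball y r) \<le> 1" by (rule sigma.prob_le_1)
  moreover have "1 * 1 \<le> (2::real) ^ DIM('a) * r ^ (DIM('a) - 1)"
    using False by (intro mult_mono one_le_power) auto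
  ultimately show ?thesis by linarith
next
  case True
  interpret sigma: prob_space "sigma_S :: 'a measure" by (rule prob_space_sigma_S)
  let ?A = "cball y r" and ?d = "DIM('a)"
  have [measurable]: "cball y u \<in> sets borel" for u by simp
  have ny: "norm y = 1" using y by (simp add: unit_sph_def)
  define w where "w = unit_ball_vol (real ?d)"
  define m where "m = measure sigma_S ?A"
  have w: "w > 0" by (simp add: w_def)
  have m: "m \<ge> 0" "emeasure sigma_S ?A = ennreal m" by (simp_all add: m_def sigma.emeasure_eq_measure)
  have pt: "indicator {..<1} (norm z) * indicator ?A (sgn z)
      \<le> indicator (cball y (2 * r)) z + indicator {..<1 - r} (norm z) * (indicator ?A (sgn z) :: ennreal)" for z
  proof (cases "norm z < 1 \<and> sgn z \<in> ?A \<and> norm z \<ge> 1 - r")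
    case True
    have "z \<noteq> 0" using True \<open>r < 1\<close> by auto
    have "z - sgn z = (1 - 1 / norm z) *\<^sub>R z"
      by (simp add: sgn_div_norm algebra_simps divide_inverse)
    then have "norm (z - sgn z) = \<bar>1 - 1 / norm z\<bar> * norm z" by simp
    also have "\<dots> = 1 - norm z"
      using True \<open>z \<noteq> 0\<close> by (simp add: abs_if field_simps)
    finally have "dist (sgn z) z \<le> r" using True by (simp add: dist_norm norm_minus_commute)
    moreover have "dist y (sgn z) \<le> r" using True by simp
    ultimately have "dist y z \<le> 2 * r" using dist_triangle[of y z "sgn z"] by linarith
    then have "z \<in> cball y (2 * r)" by simp
    then show ?thesis by (auto split: split_indicator)
  qed (auto split: split_indicator)
  have "ennreal (1 ^ ?d) * (emeasure lborel (ball (0::'a) 1) * (\<integral>\<^sup>+z. indicator ?A z \<partial>sigma_S))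
      = (\<integral>\<^sup>+z. indicator {..<1} (norm z) * indicator ?A (sgn z) \<partial>lborel)"
    by (rule nn_integral_ball_sgn[symmetric]) (auto intro!: borel_measurable_indicator)
  also have "\<dots> \<le> (\<integral>\<^sup>+z. indicator (cball y (2 * r)) z + indicator {..<1 - r} (norm z) * indicator ?A (sgn z) \<partial>lborel)"
    by (intro nn_integral_mono pt)
  also have "\<dots> = (\<integral>\<^sup>+z. indicator (cball y (2 * r)) z \<partial>lborel)
      + (\<integral>\<^sup>+z. indicator {..<1 - r} (norm z) * indicator ?A (sgn z) \<partial>lborel)"
    by (rule nn_integral_add) measurable
  also have "(\<integral>\<^sup>+z. indicator {..<1 - r} (norm z) * indicator ?A (sgn z) \<partial>lborel)
      = ennreal ((1 - r) ^ ?d) * (emeasure lborel (ball (0::'a) 1) * (\<integral>\<^sup>+z. indicator ?A z \<partial>sigma_S))"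
    by (rule nn_integral_ball_sgn) (use True in \<open>auto intro!: borel_measurable_indicator\<close>)
  finally have "ennreal w * ennreal m \<le> ennreal (w * (2 * r) ^ ?d) + ennreal ((1 - r) ^ ?d) * (ennreal w * ennreal m)"
    using r by (simp add: emeasure_ball emeasure_cball m w_def)
  then have "ennreal (w * m) \<le> ennreal (w * (2 * r) ^ ?d + (1 - r) ^ ?d * (w * m))"
    using w m(1) r True by (simp add: ennreal_mult[symmetric] ennreal_plus[symmetric] del: ennreal_plus)
  then have "w * m \<le> w * (2 * r) ^ ?d + (1 - r) ^ ?d * (w * m)"
    using w m(1) r True by (subst (asm) ennreal_le_iff) auto
  then have "w * m \<le> w * ((2 * r) ^ ?d + (1 - r) ^ ?d * m)" by (simp add: algebra_simps)
  then have "m \<le> (2 * r) ^ ?d + (1 - r) ^ ?d * m" using w by simp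
  \<comment> \<open>Replacing (1 - r)^d by 1 - r isolates m r on the left. Dividing (2 r)^d by that
    r produces the surface exponent d - 1.\<close>
  moreover have "(1 - r) ^ ?d * m \<le> (1 - r) * m"
  proof (intro mult_right_mono)
    have "(1 - r) ^ ?d \<le> (1 - r) ^ 1" using r True by (intro power_decreasing) (auto simp: Suc_leI)
    then show "(1 - r) ^ ?d \<le> 1 - r" by simp
  qed (rule m)
  ultimately have "m * r \<le> (2 * r) ^ ?d" by (simp add: algebra_simps)
  also have "\<dots> = (2 ^ ?d * r ^ (?d - 1)) * r"
    unfolding power_mult_distrib mult.assoc power_minus_mult[OF DIM_positive] ..
  finally show ?thesis using r by (simp add: m_def)
qed

text \<open>Countable subadditivity with an integral over \<open>count_space I\<close> in place of a
  series: the Vitali subfamily is a countable set of pairs, possibly finite, and needs no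
  enumeration this way.\<close>

lemma emeasure_UN_countable_le:
  assumes [measurable]: "\<And>i. i \<in> I \<Longrightarrow> X i \<in> sets M" and I: "countable I"
  shows "emeasure M (\<Union>i\<in>I. X i) \<le> (\<integral>\<^sup>+i. emeasure M (X i) \<partial>count_space I)"
proof -
  have [measurable]: "(\<Union>i\<in>I. X i) \<in> sets M" using I by (intro sets.countable_UN') auto
  have "emeasure M (\<Union>i\<in>I. X i) = (\<integral>\<^sup>+x. indicator (\<Union>i\<in>I. X i) x \<partial>M)" by simp
  also have "\<dots> \<le> (\<integral>\<^sup>+x. \<integral>\<^sup>+i. indicator (X i) x \<partial>count_space I \<partial>M)"
  proof (rule nn_integral_mono)
    fix x
    show "indicator (\<Union>i\<in>I. X i) x \<le> (\<integral>\<^sup>+i. indicator (X i) x \<partial>count_space I)"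
    proof (cases "x \<in> (\<Union>i\<in>I. X i)")
      case True
      then obtain i where "i \<in> I" "x \<in> X i" by auto
      then show ?thesis using nn_integral_ge_point[of i I "\<lambda>i. indicator (X i) x"] True by simp
    qed simp
  qed
  also have "\<dots> = (\<integral>\<^sup>+i. \<integral>\<^sup>+x. indicator (X i) x \<partial>M \<partial>count_space I)"
    using I by (intro nn_integral_count_space_nn_integral) auto
  also have "\<dots> = (\<integral>\<^sup>+i. emeasure M (X i) \<partial>count_space I)"
    by (intro nn_integral_cong) simp
  finally show ?thesis .
qed

text \<open>The weak type bound, phrased with a Borel set G containing the bad centres on the
  sphere, so that measurability of the maximal function never arises. Vitali selects disjoint balls
  on which M is large; their fivefold enlargements form G, and disjointness bounds the sum of their
  M-masses by the total mass.\<close>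

lemma maximal_cover:
  fixes M :: "'a::euclidean_space measure"
  assumes d: "DIM('a) \<ge> 2" and sM: "sets M = sets borel" and fin: "finite_measure M" and t: "t > 0"
  obtains G where "G \<in> sets borel" "measure sigma_S G \<le> 10 ^ DIM('a) * measure M UNIV / t"
    "\<And>y r. y \<in> unit_sph \<Longrightarrow> r > 0 \<Longrightarrow> y \<notin> G \<Longrightarrow> measure M (cball y r) \<le> t * r ^ (DIM('a) - 1)"
proof -
  interpret M: finite_measure M by fact
  interpret sigma: prob_space "sigma_S :: 'a measure" by (rule prob_space_sigma_S)
  note [measurable_cong] = sM
  let ?d = "DIM('a)"
  define K where "K = {(y::'a, r). y \<in> unit_sph \<and> r > 0 \<and> t * r ^ (?d - 1) < measure M (cball y r)}"
  \<comment> \<open>The covering lemma needs bounded radii. A bad ball satisfies r^(d-1) < M(UNIV) /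
    t, and r <= r^(d-1) when r > 1 because d >= 2.\<close>
  have rad: "0 < snd i \<and> snd i \<le> max 1 (measure M UNIV / t)" if "i \<in> K" for i
  proof -
    obtain y r where i: "i = (y, r)" by force
    have r: "r > 0" and lt: "t * r ^ (?d - 1) < measure M (cball y r)" using that by (auto simp: K_def i)
    have "measure M (cball y r) \<le> measure M UNIV"
      by (rule M.finite_measure_mono) (auto simp: sM)
    with lt have "r ^ (?d - 1) < measure M UNIV / t" using t by (simp add: field_simps)
    moreover have "r \<le> r ^ (?d - 1)" if "r > 1"
      using that d power_increasing[of 1 "?d - 1" r] by simp
    ultimately show ?thesis using r i by (cases "r > 1") auto
  qed
  obtain C where C: "countable C" "C \<subseteq> K"
     "pairwise (\<lambda>i j. disjnt (cball (fst i) (snd i)) (cball (fst j) (snd j))) C"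
     "\<And>i. i \<in> K \<Longrightarrow> \<exists>j. j \<in> C \<and> \<not> disjnt (cball (fst i) (snd i)) (cball (fst j) (snd j)) \<and>
                        cball (fst i) (snd i) \<subseteq> ball (fst j) (5 * snd j)"
    by (rule Vitali_covering_lemma_cballs_balls[OF rad, where a=fst]) (assumption, blast)
  define G where "G = (\<Union>j\<in>C. cball (fst j) (5 * snd j))"
  have G: "G \<in> sets borel" unfolding G_def using C(1) by (intro sets.countable_UN') auto
  \<comment> \<open>Origin of 10^d: the factor 2^d of the bound for sigma of balls, times 5^(d-1)
    from the enlargement.\<close>
  have le: "emeasure sigma_S (cball (fst j) (5 * snd j)) \<le> ennreal (10 ^ ?d / t) * emeasure M (cball (fst j) (snd j))"
    if "j \<in> C" for j
  proof -
    obtain y r where j: "j = (y, r)" by force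
    have y: "y \<in> unit_sph" "r > 0" and lt: "t * r ^ (?d - 1) < measure M (cball y r)"
      using that C(2) by (auto simp: K_def j)
    have "measure sigma_S (cball y (5 * r)) \<le> 2 ^ ?d * (5 * r) ^ (?d - 1)"
      by (rule measure_sigma_S_cball_le) (use y in auto)
    also have "\<dots> = 2 ^ ?d * 5 ^ (?d - 1) * r ^ (?d - 1)" by (simp add: power_mult_distrib)
    also have "\<dots> \<le> 2 ^ ?d * 5 ^ ?d * (measure M (cball y r) / t)"
      using lt t y(2) by (intro mult_mono power_increasing) (auto simp: field_simps)
    also have "\<dots> = 10 ^ ?d / t * measure M (cball y r)" by (simp add: power_mult_distrib[symmetric])
    finally show ?thesis
      using t by (simp add: j sigma.emeasure_eq_measure M.emeasure_eq_measure ennreal_mult[symmetric])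
  qed
  have "emeasure sigma_S G \<le> (\<integral>\<^sup>+j. emeasure sigma_S (cball (fst j) (5 * snd j)) \<partial>count_space C)"
    unfolding G_def using C(1) by (intro emeasure_UN_countable_le) auto
  also have "\<dots> \<le> (\<integral>\<^sup>+j. ennreal (10 ^ ?d / t) * emeasure M (cball (fst j) (snd j)) \<partial>count_space C)"
    using le by (intro nn_integral_mono) auto
  also have "\<dots> = ennreal (10 ^ ?d / t) * (\<integral>\<^sup>+j. emeasure M (cball (fst j) (snd j)) \<partial>count_space C)"
    by (rule nn_integral_cmult) auto
  also have "(\<integral>\<^sup>+j. emeasure M (cball (fst j) (snd j)) \<partial>count_space C) = emeasure M (\<Union>j\<in>C. cball (fst j) (snd j))"
    by (rule emeasure_UN_countable[symmetric])
       (use C sM in \<open>auto simp: disjoint_family_on_def pairwise_def disjnt_def\<close>)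
  also have "\<dots> \<le> emeasure M UNIV"
    by (rule emeasure_mono) (auto simp: sM)
  finally have "emeasure sigma_S G \<le> ennreal (10 ^ ?d / t) * emeasure M UNIV"
    by (simp add: mult_left_mono)
  then have "measure sigma_S G \<le> 10 ^ ?d / t * measure M UNIV"
    using t by (simp add: sigma.emeasure_eq_measure M.emeasure_eq_measure ennreal_mult[symmetric])
  then have m: "measure sigma_S G \<le> 10 ^ ?d * measure M UNIV / t" by simp
  have "measure M (cball y r) \<le> t * r ^ (?d - 1)" if y: "y \<in> unit_sph" "r > 0" "y \<notin> G" for y r
  proof (rule ccontr)
    assume "\<not> ?thesis"
    then have "(y, r) \<in> K" using y by (auto simp: K_def)
    from C(4)[OF this] obtain j where j: "j \<in> C" "cball y r \<subseteq> ball (fst j) (5 * snd j)" by auto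
    have "y \<in> cball y r" using y by simp
    with j have "y \<in> cball (fst j) (5 * snd j)" using ball_subset_cball by blast
    then show False using j y unfolding G_def by blast
  qed
  with G m that show thesis by blast
qed

section \<open>Bounds for the kernel and its integrals\<close>

definition PD_const :: "'a::euclidean_space itself \<Rightarrow> real \<Rightarrow> real" where
  "PD_const _ \<alpha> = C2 DIM('a) \<alpha> / Gamma (real DIM('a) / 2)"

lemma PD_const_nonneg:
  assumes "DIM('a::euclidean_space) \<ge> 2" "1 < \<alpha>"
  shows "0 \<le> PD_const TYPE('a) \<alpha>"
proof -
  have "Gamma ((\<alpha> + real DIM('a)) / 2 - 1) > 0" "Gamma ((\<alpha> - 1) / 2) > 0" "Gamma (real DIM('a) / 2) > 0"
    using assms by (auto intro!: Gamma_real_pos)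
  then show ?thesis unfolding PD_const_def C2_def by (intro divide_nonneg_nonneg mult_nonneg_nonneg) auto
qed

lemma PD_alt:
  "PD \<alpha> x z = PD_const TYPE('a) \<alpha> * (\<bar>(norm x)\<^sup>2 - 1\<bar> powr (\<alpha> - 1) / norm (x - z) powr (real DIM('a) + \<alpha> - 2))"
  for x z :: "'a::euclidean_space"
  by (simp add: PD_def PD_const_def)

lemma measurable_PD [measurable]: "PD \<alpha> x \<in> borel_measurable borel"
  unfolding PD_def by measurable

lemma PD_nonneg:
  assumes "DIM('a::euclidean_space) \<ge> 2" "1 < \<alpha>"
  shows "0 \<le> PD \<alpha> x (z::'a)"
  unfolding PD_alt using PD_const_nonneg[OF assms] by simp

lemma PD_le:
  fixes x z :: "'a::euclidean_space"
  assumes "DIM('a) \<ge> 2" "1 < \<alpha>" "0 < \<eta>" "\<eta> \<le> norm (x - z)"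
  shows "PD \<alpha> x z \<le> PD_const TYPE('a) \<alpha> * (\<bar>(norm x)\<^sup>2 - 1\<bar> powr (\<alpha> - 1) / \<eta> powr (real DIM('a) + \<alpha> - 2))"
  unfolding PD_alt using assms PD_const_nonneg[OF assms(1,2)]
  by (intro mult_left_mono divide_left_mono powr_mono2 mult_pos_pos) auto

lemma AE_unit_sph:
  assumes "fin_meas_on_S M"
  shows "AE z in M. z \<in> unit_sph"
  by (rule AE_I[of _ _ "UNIV - unit_sph"]) (use assms in \<open>auto simp: fin_meas_on_S_def unit_sph_def\<close>)

lemma abs_norm_diff_sphere:
  assumes "z \<in> unit_sph"
  shows "\<bar>1 - norm x\<bar> \<le> norm (x - z)"
  using norm_triangle_ineq3[of x z] assms by (simp add: unit_sph_def abs_minus_commute)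

lemma integrable_PD:
  fixes x :: "'a::euclidean_space"
  assumes d: "DIM('a) \<ge> 2" "1 < \<alpha>" and M: "fin_meas_on_S M" and x: "x \<in> domD"
  shows "integrable M (PD \<alpha> x)"
proof -
  have sM [measurable_cong]: "sets M = sets borel" using M by (simp add: fin_meas_on_S_def)
  interpret M: finite_measure M using M by (simp add: fin_meas_on_S_def)
  have \<eta>: "\<bar>1 - norm x\<bar> > 0" using x by (auto simp: domD_def unit_sph_def)
  let ?B = "PD_const TYPE('a) \<alpha> * (\<bar>(norm x)\<^sup>2 - 1\<bar> powr (\<alpha> - 1) / \<bar>1 - norm x\<bar> powr (real DIM('a) + \<alpha> - 2))"
  have "AE z in M. norm (PD \<alpha> x z) \<le> ?B"
    using AE_unit_sph[OF M]
  proof eventually_elim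
    case (elim z)
    show ?case using PD_le[OF d \<eta> abs_norm_diff_sphere[OF elim]] PD_nonneg[OF d, of x z] by simp
  qed
  then show ?thesis by (rule M.integrable_const_bound) auto
qed

text \<open>The 3 bounds |x| + 1 when | 1 - |x| | <= 1. The factor 2 (2 + \<beta>) compares |x - z|
  with a dyadic radius: 2 + \<beta> comes from the cone, 2 from rounding. The denominator sums a
  geometric series of ratio 2^(1 - \<alpha>).\<close>

definition cone_const :: "'a::euclidean_space itself \<Rightarrow> real \<Rightarrow> real \<Rightarrow> real" where
  "cone_const _ \<alpha> \<beta> = PD_const TYPE('a) \<alpha> * 3 powr (\<alpha> - 1) * (2 * (2 + \<beta>)) powr (real DIM('a) + \<alpha> - 2)
      / (1 - 2 powr (1 - \<alpha>))"

text \<open>The least k with the first bound works: its predecessor violates that bound, and for k =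
  0 the second follows from \<delta> <= \<rho>.\<close>

lemma dyadic_scale:
  fixes \<delta> \<rho> :: real
  assumes "0 < \<delta>" "\<delta> \<le> \<rho>"
  obtains k :: nat where "\<rho> \<le> 2 ^ k * \<delta>" "2 ^ k * \<delta> \<le> 2 * \<rho>"
proof -
  have "\<exists>k::nat. \<rho> \<le> 2 ^ k * \<delta>"
  proof -
    obtain k where "\<rho> / \<delta> < 2 ^ k" using real_arch_pow[of 2 "\<rho> / \<delta>"] by auto
    then show ?thesis using assms by (intro exI[of _ k]) (simp add: field_simps)
  qed
  define k where "k = (LEAST k. \<rho> \<le> 2 ^ k * \<delta>)"
  have k: "\<rho> \<le> 2 ^ k * \<delta>" unfolding k_def using \<open>\<exists>k::nat. \<rho> \<le> 2 ^ k * \<delta>\<close> by (rule LeastI_ex)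
  have "2 ^ k * \<delta> \<le> 2 * \<rho>"
  proof (cases k)
    case (Suc j)
    then have "\<not> \<rho> \<le> 2 ^ j * \<delta>" using not_less_Least[of j "\<lambda>k. \<rho> \<le> 2 ^ k * \<delta>"] by (simp add: k_def)
    then show ?thesis using Suc by simp
  qed (use assms in simp)
  with k that show thesis by blast
qed

text \<open>Write \<delta> for | 1 - |x| |. In the cone |x - y| < (1 + \<beta>) \<delta>, while
  \<delta> <= |x - z| for z on the sphere; hence |x - z| dominates max \<delta> |y - z| up to 2 +
  \<beta>. Sorting z by dyadic radii R = 2^k \<delta> about y, each ball contributes at most a
  constant times \<delta>^(\<alpha>-1) R^(-s) t R^(d-1), where s = d + \<alpha> - 2. Here R^(-s)
  R^(d-1) = R^(1-\<alpha>) is summable because \<alpha> > 1, and the powers of \<delta>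
  cancel.\<close>

lemma PD_integral_cone_le:
  fixes x y :: "'a::euclidean_space"
  assumes d: "DIM('a) \<ge> 2" and \<alpha>: "1 < \<alpha>" and M: "fin_meas_on_S M"
    and y: "y \<in> unit_sph" and \<beta>: "\<beta> > 0" and x: "x \<in> cone_nt \<beta> y" and x2: "\<bar>1 - norm x\<bar> \<le> 1"
    and t: "0 \<le> t" and mx: "\<And>r. r > 0 \<Longrightarrow> measure M (cball y r) \<le> t * r ^ (DIM('a) - 1)"
  shows "(\<integral>z. PD \<alpha> x z \<partial>M) \<le> cone_const TYPE('a) \<alpha> \<beta> * t"
proof -
  have sM [measurable_cong]: "sets M = sets borel" using M by (simp add: fin_meas_on_S_def)
  interpret M: finite_measure M using M by (simp add: fin_meas_on_S_def)
  define \<delta> where "\<delta> = \<bar>1 - norm x\<bar>"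
  define s where "s = real DIM('a) + \<alpha> - 2"
  define K where "K = PD_const TYPE('a) \<alpha>"
  have K: "K \<ge> 0" unfolding K_def by (rule PD_const_nonneg[OF d \<alpha>])
  have \<delta>: "\<delta> > 0" "\<delta> \<le> 1" using x x2 by (auto simp: \<delta>_def cone_nt_def domD_def unit_sph_def)
  have s: "s > 0" using d \<alpha> by (simp add: s_def)
  define A where "A = K * (3 * \<delta>) powr (\<alpha> - 1) * (2 * (2 + \<beta>)) powr s"
  have A: "A \<ge> 0" using K by (simp add: A_def)
  define R where "R k = 2 ^ k * \<delta>" for k :: nat
  have [measurable]: "cball y u \<in> sets borel" for u by simp
  have R: "R k > 0" for k using \<delta> by (simp add: R_def)
  \<comment> \<open>For a given z only the term with the dyadic index of z is used; the full sum is
    taken because that index varies with z.\<close>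
  have pt: "ennreal (PD \<alpha> x z) \<le> (\<Sum>k. ennreal (A * R k powr (- s)) * indicator (cball y (R k)) z)"
    if z: "z \<in> unit_sph" for z
  proof -
    have xz: "\<delta> \<le> norm (x - z)" unfolding \<delta>_def by (rule abs_norm_diff_sphere[OF z])
    have "norm (y - z) \<le> norm (x - y) + norm (x - z)"
      using norm_triangle_ineq4[of "x - z" "x - y"] by simp
    also have "norm (x - y) \<le> (1 + \<beta>) * \<delta>" using x by (simp add: cone_nt_def \<delta>_def)
    also have "\<dots> \<le> (1 + \<beta>) * norm (x - z)" using xz \<beta> by (intro mult_left_mono) auto
    finally have yz: "norm (y - z) \<le> (2 + \<beta>) * norm (x - z)" by (simp add: algebra_simps)
    define \<rho> where "\<rho> = max \<delta> (norm (y - z))"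
    have "\<delta> \<le> (2 + \<beta>) * norm (x - z)"
      using xz \<beta> \<delta> mult_mono[of 1 "2 + \<beta>" \<delta> "norm (x - z)"] by simp
    with yz have \<rho>: "\<rho> \<le> (2 + \<beta>) * norm (x - z)" by (simp add: \<rho>_def)
    obtain k :: nat where k: "\<rho> \<le> R k" "R k \<le> 2 * \<rho>"
      using dyadic_scale[of \<delta> \<rho>] \<delta> unfolding R_def \<rho>_def by (metis max.cobounded1)
    have zk: "z \<in> cball y (R k)" using k by (simp add: \<rho>_def dist_norm)
    have "R k \<le> 2 * (2 + \<beta>) * norm (x - z)" using k \<rho> by linarith
    then have lb: "R k / (2 * (2 + \<beta>)) \<le> norm (x - z)" using \<beta> by (simp add: field_simps)
    have "PD \<alpha> x z \<le> K * (\<bar>(norm x)\<^sup>2 - 1\<bar> powr (\<alpha> - 1) / (R k / (2 * (2 + \<beta>))) powr s)"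
      unfolding K_def s_def by (rule PD_le[OF d \<alpha> _ lb]) (use R[of k] \<beta> in auto)
    also have "\<dots> \<le> K * ((3 * \<delta>) powr (\<alpha> - 1) / (R k / (2 * (2 + \<beta>))) powr s)"
    proof (intro mult_left_mono divide_right_mono powr_mono2)
      have "(norm x)\<^sup>2 - 1 = (norm x - 1) * (norm x + 1)" by (simp add: power2_eq_square algebra_simps)
      then have "\<bar>(norm x)\<^sup>2 - 1\<bar> = \<delta> * (norm x + 1)" by (simp add: abs_mult \<delta>_def abs_minus_commute)
      also have "\<dots> \<le> \<delta> * 3" using \<delta> by (intro mult_left_mono) (auto simp: \<delta>_def)
      finally show "\<bar>(norm x)\<^sup>2 - 1\<bar> \<le> 3 * \<delta>" by simp
    qed (use \<alpha> K in auto)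
    also have "\<dots> = A * R k powr (- s)"
      using R[of k] \<beta> by (simp add: A_def powr_divide powr_minus divide_simps)
    finally have "ennreal (PD \<alpha> x z) \<le> ennreal (A * R k powr (- s)) * indicator (cball y (R k)) z"
      using zk by (simp add: ennreal_leI)
    also have "\<dots> \<le> (\<Sum>j. ennreal (A * R j powr (- s)) * indicator (cball y (R j)) z)"
    proof -
      define F where "F j = ennreal (A * R j powr (- s)) * indicator (cball y (R j)) z" for j
      have "sum F {k} \<le> suminf F" by (rule sum_le_suminf) auto
      then have "F k \<le> suminf F" by simp
      then show ?thesis unfolding F_def .
    qed
    finally show ?thesis .
  qed
  have q: "2 powr (1 - \<alpha>) < 1" "2 powr (1 - \<alpha>) > 0" using \<alpha> powr_less_one[of 2 "1 - \<alpha>"] by auto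
  have "(\<integral>\<^sup>+z. ennreal (PD \<alpha> x z) \<partial>M) \<le> (\<integral>\<^sup>+z. (\<Sum>k. ennreal (A * R k powr (- s)) * indicator (cball y (R k)) z) \<partial>M)"
    by (rule nn_integral_mono_AE, rule eventually_mono[OF AE_unit_sph[OF M] pt])
  also have "\<dots> = (\<Sum>k. \<integral>\<^sup>+z. ennreal (A * R k powr (- s)) * indicator (cball y (R k)) z \<partial>M)"
    by (rule nn_integral_suminf) measurable
  also have "\<dots> = (\<Sum>k. ennreal (A * R k powr (- s)) * emeasure M (cball y (R k)))"
    by (subst nn_integral_cmult_indicator) (auto simp: sM)
  also have "\<dots> \<le> (\<Sum>k. ennreal (A * t * \<delta> powr (1 - \<alpha>) * (2 powr (1 - \<alpha>)) ^ k))"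
  proof (intro suminf_le allI)
    fix k
    have "R k powr (- s) * R k ^ (DIM('a) - 1) = R k powr (- s) * R k powr (real DIM('a) - 1)"
      using R[of k] d by (simp add: powr_realpow[symmetric] of_nat_diff)
    also have "\<dots> = R k powr (1 - \<alpha>)" by (simp add: powr_add[symmetric] s_def)
    also have "\<dots> = \<delta> powr (1 - \<alpha>) * (2 powr (1 - \<alpha>)) ^ k"
      using \<delta> by (simp add: R_def powr_mult powr_realpow[symmetric] powr_powr mult.commute)
    finally have e: "R k powr (- s) * R k ^ (DIM('a) - 1) = \<delta> powr (1 - \<alpha>) * (2 powr (1 - \<alpha>)) ^ k" .
    have "(A * R k powr (- s)) * measure M (cball y (R k)) \<le> (A * R k powr (- s)) * (t * R k ^ (DIM('a) - 1))"
      using A by (intro mult_left_mono mx R) auto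
    also have "\<dots> = A * t * (R k powr (- s) * R k ^ (DIM('a) - 1))" by simp
    finally have "(A * R k powr (- s)) * measure M (cball y (R k)) \<le> A * t * \<delta> powr (1 - \<alpha>) * (2 powr (1 - \<alpha>)) ^ k"
      unfolding e by simp
    then show "ennreal (A * R k powr (- s)) * emeasure M (cball y (R k)) \<le> ennreal (A * t * \<delta> powr (1 - \<alpha>) * (2 powr (1 - \<alpha>)) ^ k)"
      using A by (simp add: M.emeasure_eq_measure ennreal_mult[symmetric] ennreal_leI)
  qed auto
  also have "\<dots> = ennreal (\<Sum>k. A * t * \<delta> powr (1 - \<alpha>) * (2 powr (1 - \<alpha>)) ^ k)"
    using A t q by (intro suminf_ennreal2 summable_mult summable_geometric) auto
  also have "(\<Sum>k. A * t * \<delta> powr (1 - \<alpha>) * (2 powr (1 - \<alpha>)) ^ k) = A * t * \<delta> powr (1 - \<alpha>) * (1 / (1 - 2 powr (1 - \<alpha>)))"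
    using q by (subst suminf_mult) (auto intro!: summable_geometric simp: suminf_geometric)
  also have "\<dots> = cone_const TYPE('a) \<alpha> \<beta> * t"
  proof -
    have "(3 * \<delta>) powr (\<alpha> - 1) * \<delta> powr (1 - \<alpha>) = 3 powr (\<alpha> - 1) * (\<delta> powr (\<alpha> - 1) * \<delta> powr (1 - \<alpha>))"
      using \<delta> by (simp add: powr_mult)
    also have "\<delta> powr (\<alpha> - 1) * \<delta> powr (1 - \<alpha>) = 1" using \<delta> by (simp add: powr_add[symmetric])
    finally have e: "(3 * \<delta>) powr (\<alpha> - 1) * \<delta> powr (1 - \<alpha>) = 3 powr (\<alpha> - 1)" by simp
    have "A * t * \<delta> powr (1 - \<alpha>) * (1 / (1 - 2 powr (1 - \<alpha>)))
       = K * ((3 * \<delta>) powr (\<alpha> - 1) * \<delta> powr (1 - \<alpha>)) * (2 * (2 + \<beta>)) powr s * t / (1 - 2 powr (1 - \<alpha>))"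
      by (simp only: A_def mult_ac divide_inverse mult_1_left)
    then show ?thesis unfolding e cone_const_def K_def s_def by simp
  qed
  finally have "(\<integral>\<^sup>+z. ennreal (PD \<alpha> x z) \<partial>M) \<le> ennreal (cone_const TYPE('a) \<alpha> \<beta> * t)" .
  moreover have "0 \<le> cone_const TYPE('a) \<alpha> \<beta> * t"
    using K t q unfolding cone_const_def K_def by (intro mult_nonneg_nonneg divide_nonneg_nonneg) auto
  ultimately show ?thesis by (intro integral_real_bounded)
qed

section \<open>Nontangential limits\<close>

text \<open>For x near y the distance to K stays at least \<eta> / 2, so the denominator is bounded
  below, while the numerator tends to 0 at the sphere since \<alpha> > 1. The estimate is uniform
  over such x, whence the arbitrary approach set A.\<close>

lemma PD_integral_away_tendsto_0:
  fixes y :: "'a::euclidean_space"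
  assumes d: "DIM('a) \<ge> 2" and \<alpha>: "1 < \<alpha>" and M: "fin_meas_on_S M"
    and K: "closed K" "y \<notin> K" and y: "y \<in> unit_sph"
  shows "((\<lambda>x. \<integral>z. indicator K z * PD \<alpha> x z \<partial>M) \<longlongrightarrow> 0) (at y within A)"
proof -
  have sM [measurable_cong]: "sets M = sets borel" using M by (simp add: fin_meas_on_S_def)
  interpret M: finite_measure M using M by (simp add: fin_meas_on_S_def)
  have "open (- K)" "y \<in> - K" using K by auto
  then obtain \<eta> where \<eta>: "\<eta> > 0" "ball y \<eta> \<subseteq> - K" by (auto simp: open_contains_ball)
  let ?s = "real DIM('a) + \<alpha> - 2"
  define h where "h x = PD_const TYPE('a) \<alpha> * (\<bar>(norm x)\<^sup>2 - 1\<bar> powr (\<alpha> - 1) / (\<eta> / 2) powr ?s) * measure M UNIV" for x :: 'a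
  have c0: "0 \<le> PD_const TYPE('a) \<alpha>" by (rule PD_const_nonneg[OF d \<alpha>])
  have "((\<lambda>x. \<bar>(norm x)\<^sup>2 - 1\<bar> powr (\<alpha> - 1)) \<longlongrightarrow> \<bar>(norm y)\<^sup>2 - 1\<bar> powr (\<alpha> - 1)) (at y within A)"
    using \<alpha> by (intro tendsto_powr' tendsto_intros) auto
  then have "((\<lambda>x. \<bar>(norm x)\<^sup>2 - 1\<bar> powr (\<alpha> - 1)) \<longlongrightarrow> 0) (at y within A)"
    using y by (simp add: unit_sph_def)
  then have "(h \<longlongrightarrow> PD_const TYPE('a) \<alpha> * (0 / (\<eta> / 2) powr ?s) * measure M UNIV) (at y within A)"
    unfolding h_def using \<eta> by (intro tendsto_intros) auto
  then have h0: "(h \<longlongrightarrow> 0) (at y within A)" by simp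
  have upper: "(\<integral>z. indicator K z * PD \<alpha> x z \<partial>M) \<le> h x" if x: "dist x y < \<eta> / 2" for x
  proof (rule integral_real_bounded)
    let ?B = "PD_const TYPE('a) \<alpha> * (\<bar>(norm x)\<^sup>2 - 1\<bar> powr (\<alpha> - 1) / (\<eta> / 2) powr ?s)"
    have B0: "0 \<le> ?B" using c0 by simp
    show "0 \<le> h x" using c0 by (simp add: h_def)
    have "indicator K z * PD \<alpha> x z \<le> ?B" for z
    proof (cases "z \<in> K")
      case True
      then have "z \<notin> ball y \<eta>" using \<eta> by auto
      then have "dist y z \<ge> \<eta>" by simp
      then have "\<eta> / 2 \<le> norm (x - z)"
        using x dist_triangle[of y z x] by (simp add: dist_norm norm_minus_commute)
      then have "PD \<alpha> x z \<le> ?B" by (intro PD_le[OF d \<alpha>]) (use \<eta> in auto)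
      then show ?thesis using True by simp
    qed (use B0 in simp)
    then have "(\<integral>\<^sup>+z. ennreal (indicator K z * PD \<alpha> x z) \<partial>M) \<le> (\<integral>\<^sup>+z. ennreal ?B \<partial>M)"
      by (intro nn_integral_mono ennreal_leI)
    also have "\<dots> = ennreal (h x)"
      using B0 sets_eq_imp_space_eq[OF sM] by (simp add: h_def M.emeasure_eq_measure ennreal_mult[symmetric])
    finally show "(\<integral>\<^sup>+z. ennreal (indicator K z * PD \<alpha> x z) \<partial>M) \<le> ennreal (h x)" .
  qed
  show ?thesis
  proof (rule tendsto_sandwich[OF _ _ tendsto_const h0])
    show "\<forall>\<^sub>F x in at y within A. 0 \<le> (\<integral>z. indicator K z * PD \<alpha> x z \<partial>M)"
      using PD_nonneg[OF d \<alpha>] by (intro always_eventually allI Bochner_Integration.integral_nonneg) (auto split: split_indicator)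
    show "\<forall>\<^sub>F x in at y within A. (\<integral>z. indicator K z * PD \<alpha> x z \<partial>M) \<le> h x"
      unfolding eventually_at using \<eta> upper by (intro exI[of _ "\<eta> / 2"]) auto
  qed
qed

lemma fin_meas_on_S_density:
  fixes M :: "'a::euclidean_space measure"
  assumes M: "fin_meas_on_S M" and g: "integrable M g"
  shows "fin_meas_on_S (density M (\<lambda>z. ennreal (g z)))"
proof -
  have sM [measurable_cong]: "sets M = sets borel" using M by (simp add: fin_meas_on_S_def)
  have [measurable]: "g \<in> borel_measurable M" using g by auto
  have S: "UNIV - unit_sph \<in> sets (borel :: 'a measure)" by (simp add: unit_sph_def)
  have "finite_measure (density M (\<lambda>z. ennreal (g z)))"
  proof
    have "(\<integral>\<^sup>+z. ennreal (g z) \<partial>M) \<le> (\<integral>\<^sup>+z. ennreal (norm (g z)) \<partial>M)"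
      by (intro nn_integral_mono ennreal_leI) simp
    also have "\<dots> < \<infinity>" using g by (simp add: integrable_iff_bounded)
    finally show "emeasure (density M (\<lambda>z. ennreal (g z))) (space (density M (\<lambda>z. ennreal (g z)))) \<noteq> \<infinity>"
      by (simp add: emeasure_density cong: nn_integral_cong)
  qed
  moreover have "emeasure (density M (\<lambda>z. ennreal (g z))) (UNIV - unit_sph) = 0"
  proof -
    have "UNIV - unit_sph \<in> null_sets M" using M S sM by (auto simp: fin_meas_on_S_def)
    then have "UNIV - unit_sph \<in> null_sets (density M (\<lambda>z. ennreal (g z)))"
      by (subst null_sets_density_iff) (auto dest: AE_not_in)
    then show ?thesis by auto
  qed
  ultimately show ?thesis by (simp add: fin_meas_on_S_def sM)
qed

lemma fin_meas_on_S_sigma_S: "fin_meas_on_S sigma_S"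
proof -
  interpret sigma: prob_space sigma_S by (rule prob_space_sigma_S)
  have "emeasure sigma_S (UNIV - unit_sph) = 0"
  proof -
    have "AE y in sigma_S. y \<notin> UNIV - unit_sph"
      using AE_sigma_S_sphere by eventually_elim auto
    then show ?thesis by (subst (asm) AE_iff_measurable[of "UNIV - unit_sph"]) (auto simp: unit_sph_def)
  qed
  then show ?thesis by (simp add: fin_meas_on_S_def sigma.finite_measure_axioms)
qed

lemma cone_nt_subset_domD: "cone_nt \<beta> y \<subseteq> domD"
  by (auto simp: cone_nt_def)

text \<open>The exceptional null set comes from Borel-Cantelli and is fixed before \<beta> and the
  tolerance are chosen; one null set therefore serves all apertures. The aperture only affects how
  large n must be.\<close>

lemma AE_nt_limit_null_set:
  fixes M :: "'a::euclidean_space measure"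
  assumes d: "DIM('a) \<ge> 2" and \<alpha>: "1 < \<alpha>" and M: "fin_meas_on_S M"
    and E: "E \<in> sets borel" "emeasure M E = 0"
  shows "AE y in sigma_S. y \<in> E \<longrightarrow> nt_limit (\<lambda>x. \<integral>z. PD \<alpha> x z \<partial>M) y 0"
proof -
  have sM [measurable_cong]: "sets M = sets borel" using M by (simp add: fin_meas_on_S_def)
  interpret M: finite_measure M using M by (simp add: fin_meas_on_S_def)
  interpret sigma: prob_space "sigma_S :: 'a measure" by (rule prob_space_sigma_S)
  have [simp]: "space M = UNIV" using sets_eq_imp_space_eq[OF sM] by simp
  \<comment> \<open>The mass (1/4)^n is shared out: the remainder is tested at level t = (1/2)^n,
    and the sets of bad points then have sigma-measure at most 10^d (1/2)^n, which is
    summable.\<close>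
  have "\<exists>K. compact K \<and> K \<subseteq> - E \<and> measure M (- K) < (1/4) ^ n" for n :: nat
  proof -
    have "measure M E = 0" using E by (simp add: measure_def)
    then have mE: "measure M (- E) = measure M UNIV"
      using M.finite_measure_compl[of E] E by (simp add: sM Compl_eq_Diff_UNIV)
    have "emeasure M (- E) = (SUP K \<in> {K. K \<subseteq> - E \<and> compact K}. emeasure M K)"
      by (rule inner_regular) (use sM E in auto)
    show ?thesis
    proof (rule ccontr)
      assume neg: "\<not> ?thesis"
      have "emeasure M (- E) \<le> ennreal (measure M UNIV - (1/4) ^ n)"
        unfolding \<open>emeasure M (- E) = _\<close>
      proof (rule SUP_least, clarify)
        fix K assume K: "K \<subseteq> - E" "compact K"
        then have [measurable]: "K \<in> sets borel" by (auto intro: borel_compact)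
        have "measure M (- K) = measure M UNIV - measure M K"
          using M.finite_measure_compl[of K] by (simp add: sM Compl_eq_Diff_UNIV)
        moreover have "\<not> measure M (- K) < (1/4) ^ n" using neg K by blast
        ultimately have "measure M K \<le> measure M UNIV - (1/4) ^ n" by linarith
        then show "emeasure M K \<le> ennreal (measure M UNIV - (1/4) ^ n)"
          by (simp add: M.emeasure_eq_measure ennreal_leI)
      qed
      then have le: "ennreal (measure M UNIV) \<le> ennreal (measure M UNIV - (1/4) ^ n)"
        by (simp add: M.emeasure_eq_measure mE)
      have p: "(0::real) < (1/4) ^ n" by simp
      show False
      \<comment> \<open>\<open>ennreal\<close> sends negative reals to 0. If the difference is
        negative, the inequality forces total mass 0, and then the empty compact set contradicts
        \<open>neg\<close>.\<close>
      proof (cases "measure M UNIV - (1/4) ^ n \<ge> 0")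
        case True
        then show False using le p by (simp add: ennreal_le_iff)
      next
        case False
        then have "measure M UNIV \<le> 0" using le by (simp add: ennreal_neg)
        then have "measure M (- {}) < (1/4) ^ n" using p unfolding Compl_empty_eq by linarith
        then show False using neg by (metis compact_empty empty_subsetI)
      qed
    qed
  qed
  then obtain K where K: "\<And>n. compact (K n)" "\<And>n. K n \<subseteq> - E" "\<And>n. measure M (- K n) < (1/4) ^ n"
    by metis
  have K_meas [measurable]: "K n \<in> sets borel" for n using K(1) by (rule borel_compact)
  \<comment> \<open>The part of M outside \<open>K n\<close>, written as a density so that its
    integrals become integrals over M with an indicator.\<close>
  define R where "R n = density M (\<lambda>z. ennreal (indicator (- K n) z))" for n
  have R: "fin_meas_on_S (R n)" for n
    unfolding R_def by (rule fin_meas_on_S_density[OF M]) (auto simp: sM M.emeasure_eq_measure intro!: integrable_real_indicator)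
  have R_UNIV: "measure (R n) UNIV = measure M (- K n)" for n
  proof -
    have "emeasure (R n) UNIV = emeasure M (- K n)"
      unfolding R_def by (subst emeasure_density) (auto simp: sM ennreal_indicator)
    then show ?thesis by (simp add: measure_def)
  qed
  have "\<exists>G. G \<in> sets borel \<and> measure sigma_S G \<le> 10 ^ DIM('a) * (1/2) ^ n \<and>
     (\<forall>y r. y \<in> unit_sph \<longrightarrow> r > 0 \<longrightarrow> y \<notin> G \<longrightarrow> measure (R n) (cball y r) \<le> (1/2) ^ n * r ^ (DIM('a) - 1))" for n
  proof -
    have "sets (R n) = sets borel" "finite_measure (R n)" using R[of n] by (auto simp: fin_meas_on_S_def)
    then obtain G where G: "G \<in> sets borel" "measure sigma_S G \<le> 10 ^ DIM('a) * measure (R n) UNIV / (1/2) ^ n"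
      "\<And>y r. y \<in> unit_sph \<Longrightarrow> r > 0 \<Longrightarrow> y \<notin> G \<Longrightarrow> measure (R n) (cball y r) \<le> (1/2) ^ n * r ^ (DIM('a) - 1)"
      by (rule maximal_cover[OF d, of _ "(1/2) ^ n"]) auto
    note G(2)
    also have "10 ^ DIM('a) * measure (R n) UNIV / (1/2) ^ n \<le> 10 ^ DIM('a) * (1/4) ^ n / (1/2) ^ n"
      using K(3)[of n] by (intro divide_right_mono mult_left_mono) (auto simp: R_UNIV)
    also have "\<dots> = 10 ^ DIM('a) * ((1/4) / (1/2)) ^ n" by (simp only: power_divide times_divide_eq_right)
    also have "(1/4) / (1/2) = (1/2 :: real)" by simp
    finally show ?thesis using G by blast
  qed
  then obtain G where G: "\<And>n. G n \<in> sets borel" "\<And>n. measure sigma_S (G n) \<le> 10 ^ DIM('a) * (1/2) ^ n"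
     "\<And>n y r. y \<in> unit_sph \<Longrightarrow> r > 0 \<Longrightarrow> y \<notin> G n \<Longrightarrow> measure (R n) (cball y r) \<le> (1/2) ^ n * r ^ (DIM('a) - 1)"
    by metis
  have "AE y in sigma_S. \<forall>\<^sub>F n in sequentially. y \<in> space sigma_S - G n"
  proof (rule borel_cantelli_AE1)
    show "summable (\<lambda>n. measure sigma_S (G n))"
      by (rule summable_comparison_test[of _ "\<lambda>n. 10 ^ DIM('a) * (1/2) ^ n"])
         (use G(2) in \<open>auto intro!: summable_mult summable_geometric\<close>)
  qed (use G(1) in \<open>auto simp: sigma.emeasure_eq_measure\<close>)
  with AE_sigma_S_sphere show ?thesis
  proof eventually_elim
    case (elim y)
    then have y: "y \<in> unit_sph" and ev: "\<forall>\<^sub>F n in sequentially. y \<notin> G n" by auto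
    show ?case unfolding nt_limit_def
    proof (intro impI allI tendstoI)
      fix \<beta> \<epsilon> :: real assume yE: "y \<in> E" and \<beta>: "\<beta> > 0" and \<epsilon>: "\<epsilon> > 0"
      let ?F = "at y within cone_nt \<beta> y"
      have "(\<lambda>n. cone_const TYPE('a) \<alpha> \<beta> * (1/2) ^ n) \<longlonglongrightarrow> cone_const TYPE('a) \<alpha> \<beta> * 0"
        by (intro tendsto_intros) auto
      then have "\<forall>\<^sub>F n in sequentially. cone_const TYPE('a) \<alpha> \<beta> * (1/2) ^ n < \<epsilon> / 2"
        using \<epsilon> by (intro order_tendstoD(2)) auto
      with ev have "\<forall>\<^sub>F n in sequentially. y \<notin> G n \<and> cone_const TYPE('a) \<alpha> \<beta> * (1/2) ^ n < \<epsilon> / 2"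
        by eventually_elim simp
      then obtain n where n: "y \<notin> G n" "cone_const TYPE('a) \<alpha> \<beta> * (1/2) ^ n < \<epsilon> / 2"
        by (auto simp: eventually_sequentially)
      have "y \<notin> K n" using K(2) yE by auto
      then have "((\<lambda>x. \<integral>z. indicator (K n) z * PD \<alpha> x z \<partial>M) \<longlongrightarrow> 0) ?F"
        using K(1) by (intro PD_integral_away_tendsto_0[OF d \<alpha> M _ _ y]) (auto intro: compact_imp_closed)
      then have e1: "\<forall>\<^sub>F x in ?F. (\<integral>z. indicator (K n) z * PD \<alpha> x z \<partial>M) < \<epsilon> / 2"
        using \<epsilon> by (intro order_tendstoD(2)) auto
      have "((\<lambda>x. \<bar>1 - norm x\<bar>) \<longlongrightarrow> \<bar>1 - norm y\<bar>) ?F" by (intro tendsto_intros)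
      then have e2: "\<forall>\<^sub>F x in ?F. \<bar>1 - norm x\<bar> < 1"
        using y by (intro order_tendstoD(2)) (auto simp: unit_sph_def)
      have e3: "\<forall>\<^sub>F x in ?F. x \<in> cone_nt \<beta> y" by (simp add: eventually_at_filter)
      from e1 e2 e3 show "\<forall>\<^sub>F x in ?F. dist (\<integral>z. PD \<alpha> x z \<partial>M) 0 < \<epsilon>"
      proof eventually_elim
        case (elim x)
        have xD: "x \<in> domD" using elim(3) cone_nt_subset_domD by blast
        have int: "integrable M (PD \<alpha> x)" by (rule integrable_PD[OF d \<alpha> M xD])
        have "(\<integral>z. PD \<alpha> x z \<partial>M) = (\<integral>z. indicator (K n) z * PD \<alpha> x z + indicator (- K n) z * PD \<alpha> x z \<partial>M)"
          by (intro Bochner_Integration.integral_cong) (auto split: split_indicator)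
        also have "\<dots> = (\<integral>z. indicator (K n) z * PD \<alpha> x z \<partial>M) + (\<integral>z. indicator (- K n) z * PD \<alpha> x z \<partial>M)"
          using integrable_mult_indicator[OF _ int] by (intro Bochner_Integration.integral_add) (auto simp: sM)
        also have "(\<integral>z. indicator (- K n) z * PD \<alpha> x z \<partial>M) = (\<integral>z. PD \<alpha> x z \<partial>R n)"
          unfolding R_def by (subst integral_density) auto
        also have "\<dots> \<le> cone_const TYPE('a) \<alpha> \<beta> * (1/2) ^ n"
          using elim n(1) G(3)[OF y] by (intro PD_integral_cone_le[OF d \<alpha> R y \<beta>]) auto
        finally have "(\<integral>z. PD \<alpha> x z \<partial>M) < \<epsilon>" using elim(1) n(2) by linarith
        moreover have "0 \<le> (\<integral>z. PD \<alpha> x z \<partial>M)" using PD_nonneg[OF d \<alpha>] by (intro Bochner_Integration.integral_nonneg) auto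
        ultimately show ?case by simp
      qed
    qed
  qed
qed

text \<open>The squeeze rests on q - (q - f)^+ <= f <= q + (f - q)^+, multiplied by the nonnegative
  kernel and integrated; the constant term q P[sigma] tends to q. Restricting to rational q keeps
  the union of exceptional sets null.\<close>

lemma AE_nt_limit_density:
  fixes f :: "'a::euclidean_space \<Rightarrow> real"
  assumes d: "DIM('a) \<ge> 2" and \<alpha>: "1 < \<alpha>" and f: "integrable sigma_S f"
  shows "AE y in sigma_S. nt_limit (\<lambda>x. \<integral>z. f z * PD \<alpha> x z \<partial>sigma_S) y (f y)"
proof -
  interpret sigma: prob_space "sigma_S :: 'a measure" by (rule prob_space_sigma_S)
  have f_meas [measurable]: "f \<in> borel_measurable borel" using f by (auto dest: borel_measurable_integrable)
  \<comment> \<open>The measure with density \<open>max 0 (g z)\<close> vanishes on {g <= 0}, so the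
    null set lemma applies there; g will be f - q and q - f.\<close>
  have pos: "AE y in sigma_S. g y \<le> 0 \<longrightarrow> nt_limit (\<lambda>x. \<integral>z. max 0 (g z) * PD \<alpha> x z \<partial>sigma_S) y 0"
    if g: "integrable sigma_S g" for g :: "'a \<Rightarrow> real"
  proof -
    have [measurable]: "g \<in> borel_measurable borel" using g by (auto dest: borel_measurable_integrable)
    let ?M = "density sigma_S (\<lambda>z. ennreal (max 0 (g z)))"
    have M: "fin_meas_on_S ?M"
      using g by (intro fin_meas_on_S_density fin_meas_on_S_sigma_S) auto
    have E: "{z. g z \<le> 0} \<in> sets borel" by measurable
    have "emeasure ?M {z. g z \<le> 0} = (\<integral>\<^sup>+z. ennreal (max 0 (g z)) * indicator {z. g z \<le> 0} z \<partial>sigma_S)"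
      by (rule emeasure_density) auto
    also have "\<dots> = (\<integral>\<^sup>+z. 0 \<partial>(sigma_S :: 'a measure))"
      by (intro nn_integral_cong) (auto split: split_indicator)
    finally have E0: "emeasure ?M {z. g z \<le> 0} = 0" by simp
    have "(\<integral>z. PD \<alpha> x z \<partial>?M) = (\<integral>z. max 0 (g z) * PD \<alpha> x z \<partial>sigma_S)" for x
      by (subst integral_density) auto
    with AE_nt_limit_null_set[OF d \<alpha> M E E0] show ?thesis by simp
  qed
  have "AE y in sigma_S. \<forall>q\<in>\<rat>. (f y - q \<le> 0 \<longrightarrow> nt_limit (\<lambda>x. \<integral>z. max 0 (f z - q) * PD \<alpha> x z \<partial>sigma_S) y 0) \<and>
      (q - f y \<le> 0 \<longrightarrow> nt_limit (\<lambda>x. \<integral>z. max 0 (q - f z) * PD \<alpha> x z \<partial>sigma_S) y 0)"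
  proof (rule AE_ball_countable')
    fix q :: real
    show "AE y in sigma_S. (f y - q \<le> 0 \<longrightarrow> nt_limit (\<lambda>x. \<integral>z. max 0 (f z - q) * PD \<alpha> x z \<partial>sigma_S) y 0) \<and>
      (q - f y \<le> 0 \<longrightarrow> nt_limit (\<lambda>x. \<integral>z. max 0 (q - f z) * PD \<alpha> x z \<partial>sigma_S) y 0)"
      using pos[of "\<lambda>z. f z - q"] pos[of "\<lambda>z. q - f z"] f by auto
  qed (rule countable_rat)
  with AE_sigma_S_sphere show ?thesis
  proof eventually_elim
    case (elim y)
    then have y: "y \<in> unit_sph"
      and up: "\<And>q. q \<in> \<rat> \<Longrightarrow> f y \<le> q \<Longrightarrow> nt_limit (\<lambda>x. \<integral>z. max 0 (f z - q) * PD \<alpha> x z \<partial>sigma_S) y 0"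
      and lo: "\<And>q. q \<in> \<rat> \<Longrightarrow> q \<le> f y \<Longrightarrow> nt_limit (\<lambda>x. \<integral>z. max 0 (q - f z) * PD \<alpha> x z \<partial>sigma_S) y 0"
      by auto
    show ?case unfolding nt_limit_def
    proof (intro allI impI)
      fix \<beta> :: real assume \<beta>: "\<beta> > 0"
      let ?F = "at y within cone_nt \<beta> y"
      have one: "((\<lambda>x. \<integral>z. PD \<alpha> x z \<partial>sigma_S) \<longlongrightarrow> 1) ?F"
        using PD_sigma_tendsto_1[OF d \<alpha> y] cone_nt_subset_domD by (rule tendsto_within_subset)
      have D: "\<forall>\<^sub>F x in ?F. x \<in> domD"
        using cone_nt_subset_domD[of \<beta> y] by (auto simp: eventually_at_filter intro!: always_eventually)
      \<comment> \<open>Integrability of g times the kernel is that of the kernel against the finite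
        measure |g| sigma.\<close>
      have int: "integrable sigma_S (\<lambda>z. g z * PD \<alpha> x z)" if g: "integrable sigma_S g" and x: "x \<in> domD"
        for g :: "'a \<Rightarrow> real" and x
      proof -
        have [measurable]: "g \<in> borel_measurable borel" using g by (auto dest: borel_measurable_integrable)
        let ?M = "density sigma_S (\<lambda>z. ennreal (norm (g z)))"
        have "fin_meas_on_S ?M" using g by (intro fin_meas_on_S_density fin_meas_on_S_sigma_S) auto
        then have "integrable ?M (PD \<alpha> x)" by (rule integrable_PD[OF d \<alpha> _ x])
        then have "integrable sigma_S (\<lambda>z. norm (g z) * PD \<alpha> x z)"
          by (subst (asm) integrable_density) auto
        then show ?thesis by (rule Bochner_Integration.integrable_bound) (auto simp: abs_mult)
      qed
      show "((\<lambda>x. \<integral>z. f z * PD \<alpha> x z \<partial>sigma_S) \<longlongrightarrow> f y) ?F"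
      proof (rule order_tendstoI)
        fix a assume "f y < a"
        then obtain q where q: "q \<in> \<rat>" "f y < q" "q < a" using Rats_dense_in_real by blast
        have "((\<lambda>x. \<integral>z. max 0 (f z - q) * PD \<alpha> x z \<partial>sigma_S) \<longlongrightarrow> 0) ?F"
          using up[OF q(1)] q \<beta> by (simp add: nt_limit_def)
        then have "((\<lambda>x. q * (\<integral>z. PD \<alpha> x z \<partial>sigma_S) + (\<integral>z. max 0 (f z - q) * PD \<alpha> x z \<partial>sigma_S)) \<longlongrightarrow> q * 1 + 0) ?F"
          by (intro tendsto_add tendsto_mult tendsto_const one)
        then have "\<forall>\<^sub>F x in ?F. q * (\<integral>z. PD \<alpha> x z \<partial>sigma_S) + (\<integral>z. max 0 (f z - q) * PD \<alpha> x z \<partial>sigma_S) < a"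
          using q by (intro order_tendstoD(2)) auto
        with D show "\<forall>\<^sub>F x in ?F. (\<integral>z. f z * PD \<alpha> x z \<partial>sigma_S) < a"
        proof eventually_elim
          case (elim x)
          have i1: "integrable sigma_S (PD \<alpha> x)" by (rule integrable_PD[OF d \<alpha> fin_meas_on_S_sigma_S elim(1)])
          have i2: "integrable sigma_S (\<lambda>z. max 0 (f z - q) * PD \<alpha> x z)" using f by (intro int elim(1)) auto
          have "(\<integral>z. f z * PD \<alpha> x z \<partial>sigma_S) \<le> (\<integral>z. q * PD \<alpha> x z + max 0 (f z - q) * PD \<alpha> x z \<partial>sigma_S)"
          proof (rule integral_mono)
            show "f z * PD \<alpha> x z \<le> q * PD \<alpha> x z + max 0 (f z - q) * PD \<alpha> x z" for z
              unfolding distrib_right[symmetric] using PD_nonneg[OF d \<alpha>, of x z] by (intro mult_right_mono) auto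
          qed (use i1 i2 int[OF f elim(1)] in auto)
          also have "\<dots> = q * (\<integral>z. PD \<alpha> x z \<partial>sigma_S) + (\<integral>z. max 0 (f z - q) * PD \<alpha> x z \<partial>sigma_S)"
            using i1 i2 by simp
          finally show ?case using elim(2) by linarith
        qed
      next
        fix a assume "a < f y"
        then obtain q where q: "q \<in> \<rat>" "a < q" "q < f y" using Rats_dense_in_real by blast
        have "((\<lambda>x. \<integral>z. max 0 (q - f z) * PD \<alpha> x z \<partial>sigma_S) \<longlongrightarrow> 0) ?F"
          using lo[OF q(1)] q \<beta> by (simp add: nt_limit_def)
        then have "((\<lambda>x. q * (\<integral>z. PD \<alpha> x z \<partial>sigma_S) - (\<integral>z. max 0 (q - f z) * PD \<alpha> x z \<partial>sigma_S)) \<longlongrightarrow> q * 1 - 0) ?F"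
          by (intro tendsto_diff tendsto_mult tendsto_const one)
        then have "\<forall>\<^sub>F x in ?F. a < q * (\<integral>z. PD \<alpha> x z \<partial>sigma_S) - (\<integral>z. max 0 (q - f z) * PD \<alpha> x z \<partial>sigma_S)"
          using q by (intro order_tendstoD(1)) auto
        with D show "\<forall>\<^sub>F x in ?F. a < (\<integral>z. f z * PD \<alpha> x z \<partial>sigma_S)"
        proof eventually_elim
          case (elim x)
          have i1: "integrable sigma_S (PD \<alpha> x)" by (rule integrable_PD[OF d \<alpha> fin_meas_on_S_sigma_S elim(1)])
          have i2: "integrable sigma_S (\<lambda>z. max 0 (q - f z) * PD \<alpha> x z)" using f by (intro int elim(1)) auto
          have "(\<integral>z. q * PD \<alpha> x z - max 0 (q - f z) * PD \<alpha> x z \<partial>sigma_S) \<le> (\<integral>z. f z * PD \<alpha> x z \<partial>sigma_S)"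
          proof (rule integral_mono)
            show "q * PD \<alpha> x z - max 0 (q - f z) * PD \<alpha> x z \<le> f z * PD \<alpha> x z" for z
              unfolding left_diff_distrib[symmetric] using PD_nonneg[OF d \<alpha>, of x z] by (intro mult_right_mono) auto
          qed (use i1 i2 int[OF f elim(1)] in auto)
          moreover have "(\<integral>z. q * PD \<alpha> x z - max 0 (q - f z) * PD \<alpha> x z \<partial>sigma_S)
             = q * (\<integral>z. PD \<alpha> x z \<partial>sigma_S) - (\<integral>z. max 0 (q - f z) * PD \<alpha> x z \<partial>sigma_S)"
            using i1 i2 by simp
          ultimately show ?case using elim(2) by linarith
        qed
      qed
    qed
  qed
qed

lemma nn_integral_eq_of_emeasure_sum_eq:
  assumes [measurable_cong]: "sets M1 = sets B" "sets M2 = sets B" "sets M3 = sets B"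
      "sets N1 = sets B" "sets N2 = sets B" "sets N3 = sets B"
    and eq: "\<And>A. A \<in> sets B \<Longrightarrow> emeasure M1 A + emeasure M2 A + emeasure M3 A = emeasure N1 A + emeasure N2 A + emeasure N3 A"
    and g: "g \<in> borel_measurable B"
  shows "integral\<^sup>N M1 g + integral\<^sup>N M2 g + integral\<^sup>N M3 g = integral\<^sup>N N1 g + integral\<^sup>N N2 g + integral\<^sup>N N3 g"
  using g
proof (induction rule: borel_measurable_induct)
  case (cong f g)
  have sp: "space M1 = space B" "space M2 = space B" "space M3 = space B"
     "space N1 = space B" "space N2 = space B" "space N3 = space B"
    using assms(1-6) by (auto dest: sets_eq_imp_space_eq)
  have "integral\<^sup>N M f = integral\<^sup>N M g" if "space M = space B" for M
    using cong(3) that by (intro nn_integral_cong) auto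
  then show ?case using cong(4) sp by simp
next
  case (set A)
  then show ?case using eq assms(1-6) by simp
next
  case (mult u c)
  note [measurable] = mult(2)
  have "c * (integral\<^sup>N M1 u + integral\<^sup>N M2 u + integral\<^sup>N M3 u) = c * (integral\<^sup>N N1 u + integral\<^sup>N N2 u + integral\<^sup>N N3 u)"
    using mult by simp
  then show ?case by (simp add: nn_integral_cmult distrib_left)
next
  case (add u v)
  note [measurable] = add(1) add(3)
  have "(integral\<^sup>N M1 v + integral\<^sup>N M2 v + integral\<^sup>N M3 v) + (integral\<^sup>N M1 u + integral\<^sup>N M2 u + integral\<^sup>N M3 u)
      = (integral\<^sup>N N1 v + integral\<^sup>N N2 v + integral\<^sup>N N3 v) + (integral\<^sup>N N1 u + integral\<^sup>N N2 u + integral\<^sup>N N3 u)"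
    using add by simp
  then show ?case by (simp add: nn_integral_add add_ac)
next
  case (seq U)
  note [measurable] = seq(1)
  have sup: "integral\<^sup>N M (SUP i. U i) = (SUP i. integral\<^sup>N M (U i))" if [measurable_cong]: "sets M = sets B" for M
    unfolding SUP_apply[abs_def] by (rule nn_integral_monotone_convergence_SUP[OF seq(3)]) measurable
  have lim: "(\<lambda>i. integral\<^sup>N M (U i)) \<longlonglongrightarrow> integral\<^sup>N M (SUP i. U i)" if [measurable_cong]: "sets M = sets B" for M
    unfolding sup[OF that] using seq(3) by (intro LIMSEQ_SUP incseq_nn_integral)
  have "(\<lambda>i. integral\<^sup>N M1 (U i) + integral\<^sup>N M2 (U i) + integral\<^sup>N M3 (U i))
      \<longlonglongrightarrow> integral\<^sup>N M1 (SUP i. U i) + integral\<^sup>N M2 (SUP i. U i) + integral\<^sup>N M3 (SUP i. U i)"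
    by (intro tendsto_add lim assms)
  moreover have "(\<lambda>i. integral\<^sup>N M1 (U i) + integral\<^sup>N M2 (U i) + integral\<^sup>N M3 (U i))
      \<longlonglongrightarrow> integral\<^sup>N N1 (SUP i. U i) + integral\<^sup>N N2 (SUP i. U i) + integral\<^sup>N N3 (SUP i. U i)"
    unfolding seq.IH by (intro tendsto_add lim assms)
  ultimately show ?case by (rule LIMSEQ_unique)
qed

theorem theorem3p11:
  fixes \<alpha> :: real and f :: "'a::euclidean_space \<Rightarrow> real"
    and Mp Mn Np Nn :: "'a measure"
  assumes "DIM('a) \<ge> 2" and "1 < \<alpha>" and "\<alpha> < 2"
    and "fin_meas_on_S Mp" and "fin_meas_on_S Mn"
    and "fin_meas_on_S Np" and "fin_meas_on_S Nn"
    and f_int: "integrable sigma_S f"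
    and sing: "\<exists>N\<in>sets borel. emeasure sigma_S N = 0 \<and>
                 emeasure Np (UNIV - N) = 0 \<and> emeasure Nn (UNIV - N) = 0"
    and decomp: "\<forall>A\<in>sets borel. measure Mp A - measure Mn A =
                   (LINT x:A|sigma_S. f x) + (measure Np A - measure Nn A)"
  shows "AE y in sigma_S. nt_limit (PD_int \<alpha> Mp Mn) y (f y)"
proof -
  note d = assms(1) and \<alpha> = assms(2)
  note fin = assms(4-7)
  have s: "sets Mp = sets borel" "sets Mn = sets borel" "sets Np = sets borel" "sets Nn = sets borel"
    using fin by (auto simp: fin_meas_on_S_def)
  interpret Mp: finite_measure Mp using fin by (simp add: fin_meas_on_S_def)
  interpret Mn: finite_measure Mn using fin by (simp add: fin_meas_on_S_def)
  interpret Np: finite_measure Np using fin by (simp add: fin_meas_on_S_def)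
  interpret Nn: finite_measure Nn using fin by (simp add: fin_meas_on_S_def)
  have f_meas [measurable]: "f \<in> borel_measurable borel" using f_int by (auto dest: borel_measurable_integrable)
  define Fp where "Fp = density sigma_S (\<lambda>z. ennreal (max 0 (f z)))"
  define Fn where "Fn = density sigma_S (\<lambda>z. ennreal (max 0 (- f z)))"
  have ip: "integrable sigma_S (\<lambda>z. max 0 (f z))" and i_n: "integrable sigma_S (\<lambda>z. max 0 (- f z))"
    using f_int by auto
  have F: "fin_meas_on_S Fp" "fin_meas_on_S Fn" unfolding Fp_def Fn_def
    by (intro fin_meas_on_S_density fin_meas_on_S_sigma_S ip i_n)+
  interpret Fp: finite_measure Fp using F by (simp add: fin_meas_on_S_def)
  interpret Fn: finite_measure Fn using F by (simp add: fin_meas_on_S_def)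
  have sF: "sets Fp = sets borel" "sets Fn = sets borel" by (simp_all add: Fp_def Fn_def)
  have meas_density: "measure (density sigma_S (\<lambda>z. ennreal (g z))) A = (LINT z|sigma_S. indicator A z * g z)"
    if g: "integrable sigma_S g" "\<And>z. 0 \<le> g z" and [measurable]: "A \<in> sets borel" for g :: "'a \<Rightarrow> real" and A
  proof -
    have [measurable]: "g \<in> borel_measurable borel" using g by (auto dest: borel_measurable_integrable)
    have "emeasure (density sigma_S (\<lambda>z. ennreal (g z))) A = (\<integral>\<^sup>+z. ennreal (indicator A z * g z) \<partial>sigma_S)"
      by (subst emeasure_density) (auto intro!: nn_integral_cong split: split_indicator)
    also have "\<dots> = ennreal (LINT z|sigma_S. indicator A z * g z)"
      using g integrable_mult_indicator[OF _ g(1), of A] by (intro nn_integral_eq_integral) auto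
    finally show ?thesis using g by (simp add: measure_def Bochner_Integration.integral_nonneg)
  qed
  \<comment> \<open>The pairs given represent mu and nu only through their differences, so positive
    parts cannot be compared one by one. With f split into positive and negative parts, moving every
    negative term across gives an identity between positive measures.\<close>
  have key: "emeasure Mp A + emeasure Nn A + emeasure Fn A = emeasure Mn A + emeasure Np A + emeasure Fp A"
    if [measurable]: "A \<in> sets borel" for A
  proof -
    have "(LINT x:A|sigma_S. f x) = (LINT z|sigma_S. indicator A z * max 0 (f z) - indicator A z * max 0 (- f z))"
      unfolding set_lebesgue_integral_def by (intro Bochner_Integration.integral_cong) (auto split: split_indicator)
    also have "\<dots> = measure Fp A - measure Fn A"
      using integrable_mult_indicator[OF _ ip, of A] integrable_mult_indicator[OF _ i_n, of A]
      unfolding Fp_def Fn_def by (subst Bochner_Integration.integral_diff) (auto simp: meas_density ip i_n)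
    finally have "measure Mp A - measure Mn A = measure Fp A - measure Fn A + (measure Np A - measure Nn A)"
      using decomp that by simp
    then have "measure Mp A + measure Nn A + measure Fn A = measure Mn A + measure Np A + measure Fp A" by linarith
    then show ?thesis
      by (simp add: Mp.emeasure_eq_measure Mn.emeasure_eq_measure Np.emeasure_eq_measure Nn.emeasure_eq_measure
          Fp.emeasure_eq_measure Fn.emeasure_eq_measure ennreal_plus[symmetric] del: ennreal_plus)
  qed
  \<comment> \<open>For x off the sphere all six kernel integrals are finite, so the
    \<open>ennreal\<close> identity descends to the reals and can be rearranged there.\<close>
  have eq: "PD_int \<alpha> Mp Mn x = (\<integral>z. f z * PD \<alpha> x z \<partial>sigma_S) + (\<integral>z. PD \<alpha> x z \<partial>Np) - (\<integral>z. PD \<alpha> x z \<partial>Nn)"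
    if x: "x \<in> domD" for x
  proof -
    have nn: "(\<integral>\<^sup>+z. ennreal (PD \<alpha> x z) \<partial>M) = ennreal (\<integral>z. PD \<alpha> x z \<partial>M)" "0 \<le> (\<integral>z. PD \<alpha> x z \<partial>M)" if "fin_meas_on_S M" for M
      using integrable_PD[OF d \<alpha> that x] PD_nonneg[OF d \<alpha>] by (auto intro!: nn_integral_eq_integral Bochner_Integration.integral_nonneg)
    have "(\<integral>\<^sup>+z. ennreal (PD \<alpha> x z) \<partial>Mp) + (\<integral>\<^sup>+z. ennreal (PD \<alpha> x z) \<partial>Nn) + (\<integral>\<^sup>+z. ennreal (PD \<alpha> x z) \<partial>Fn)
       = (\<integral>\<^sup>+z. ennreal (PD \<alpha> x z) \<partial>Mn) + (\<integral>\<^sup>+z. ennreal (PD \<alpha> x z) \<partial>Np) + (\<integral>\<^sup>+z. ennreal (PD \<alpha> x z) \<partial>Fp)"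
      by (rule nn_integral_eq_of_emeasure_sum_eq[where B=borel]) (use s sF key in auto)
    then have "(\<integral>z. PD \<alpha> x z \<partial>Mp) + (\<integral>z. PD \<alpha> x z \<partial>Nn) + (\<integral>z. PD \<alpha> x z \<partial>Fn)
      = (\<integral>z. PD \<alpha> x z \<partial>Mn) + (\<integral>z. PD \<alpha> x z \<partial>Np) + (\<integral>z. PD \<alpha> x z \<partial>Fp)"
      using nn[OF fin(1)] nn[OF fin(2)] nn[OF fin(3)] nn[OF fin(4)] nn[OF F(1)] nn[OF F(2)]
      by (simp add: ennreal_plus[symmetric] del: ennreal_plus)
    moreover have "(\<integral>z. PD \<alpha> x z \<partial>Fp) - (\<integral>z. PD \<alpha> x z \<partial>Fn) = (\<integral>z. f z * PD \<alpha> x z \<partial>sigma_S)"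
    proof -
      have "integrable Fp (PD \<alpha> x)" "integrable Fn (PD \<alpha> x)" using integrable_PD[OF d \<alpha> _ x] F by auto
      then have "integrable sigma_S (\<lambda>z. max 0 (f z) * PD \<alpha> x z)" "integrable sigma_S (\<lambda>z. max 0 (- f z) * PD \<alpha> x z)"
        unfolding Fp_def Fn_def by (subst (asm) (1 2) integrable_density; simp)+
      then have "(\<integral>z. max 0 (f z) * PD \<alpha> x z \<partial>sigma_S) - (\<integral>z. max 0 (- f z) * PD \<alpha> x z \<partial>sigma_S)
         = (\<integral>z. max 0 (f z) * PD \<alpha> x z - max 0 (- f z) * PD \<alpha> x z \<partial>sigma_S)" by simp
      also have "\<dots> = (\<integral>z. f z * PD \<alpha> x z \<partial>sigma_S)"
        by (intro Bochner_Integration.integral_cong) (auto simp: max_def)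
      finally show ?thesis unfolding Fp_def Fn_def by (simp add: integral_density)
    qed
    ultimately show ?thesis unfolding PD_int_def by linarith
  qed
  obtain N where N: "N \<in> sets borel" "emeasure sigma_S N = 0" "emeasure Np (UNIV - N) = 0" "emeasure Nn (UNIV - N) = 0"
    using sing by blast
  have "AE y in sigma_S. y \<notin> N" using N by (intro AE_not_in) auto
  moreover have "AE y in sigma_S. y \<in> UNIV - N \<longrightarrow> nt_limit (\<lambda>x. \<integral>z. PD \<alpha> x z \<partial>Np) y 0"
    using N by (intro AE_nt_limit_null_set[OF d \<alpha> fin(3)]) auto
  moreover have "AE y in sigma_S. y \<in> UNIV - N \<longrightarrow> nt_limit (\<lambda>x. \<integral>z. PD \<alpha> x z \<partial>Nn) y 0"
    using N by (intro AE_nt_limit_null_set[OF d \<alpha> fin(4)]) auto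
  moreover note AE_nt_limit_density[OF d \<alpha> f_int]
  ultimately show ?thesis
  proof eventually_elim
    case (elim y)
    show ?case unfolding nt_limit_def
    proof (intro allI impI)
      fix \<beta> :: real assume \<beta>: "\<beta> > 0"
      let ?F = "at y within cone_nt \<beta> y"
      have "((\<lambda>x. (\<integral>z. f z * PD \<alpha> x z \<partial>sigma_S) + (\<integral>z. PD \<alpha> x z \<partial>Np) - (\<integral>z. PD \<alpha> x z \<partial>Nn)) \<longlongrightarrow> f y + 0 - 0) ?F"
        using elim \<beta> by (intro tendsto_add tendsto_diff) (auto simp: nt_limit_def)
      moreover have "\<forall>\<^sub>F x in ?F. (\<integral>z. f z * PD \<alpha> x z \<partial>sigma_S) + (\<integral>z. PD \<alpha> x z \<partial>Np) - (\<integral>z. PD \<alpha> x z \<partial>Nn) = PD_int \<alpha> Mp Mn x"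
        using eq cone_nt_subset_domD[of \<beta> y] by (auto simp: eventually_at_filter intro!: always_eventually)
      ultimately show "(PD_int \<alpha> Mp Mn \<longlongrightarrow> f y) ?F"
        by (auto intro: Lim_transform_eventually)
    qed
  qed
qed

end
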